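(* For any bounded operator $S\in\mathfrak{L}(\mathcal{F}^2)$ on the Fock space $\mathcal{F}^2=\mathcal{F}^2(\mathbb{C}^n)$ there exists a sequence of Toeplitz operators with (bounded) uniformly continuous symbols which converges to $S$ in the strong operator topology.
   Context: Let $d\lambda(z)=e^{-\pi|z|^2}dz$ on $\mathbb{C}^n$ ($dz$ Lebesgue measure). The Fock space $\mathcal{F}^2(\mathbb{C}^n)$ is the closed subspace of holomorphic functions in $L^2(\mathbb{C}^n,d\lambda)$, and $\mathfrak{L}(\mathcal{F}^2)$ is the algebra of bounded operators on it. For $a\in L^\infty(\mathbb{C}^n)$, the Toeplitz operator with symbol $a$ is $T_af=P(af)$, where $P:L^2(\mathbb{C}^n,d\lambda)\to\mathcal{F}^2$ is the orthogonal projection. Symbols of Toeplitz operators are always bounded functions. *)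

theory Defs
  imports "HOL-Analysis.Analysis"
begin

definition fock_measure :: "(complex ^ 'n) measure" where
  "fock_measure = density lborel (\<lambda>z. ennreal (exp (- pi * (norm z)\<^sup>2)))"

definition fock_L2 :: "(complex ^ 'n \<Rightarrow> complex) set" where
  "fock_L2 = {f \<in> borel_measurable fock_measure.
      integrable fock_measure (\<lambda>z. (cmod (f z))\<^sup>2)}"

definition fock_inner :: "(complex ^ 'n \<Rightarrow> complex) \<Rightarrow> (complex ^ 'n \<Rightarrow> complex) \<Rightarrow> complex" where
  "fock_inner f g = (LINT z|fock_measure. f z * cnj (g z))"

definition fock_norm :: "(complex ^ 'n \<Rightarrow> complex) \<Rightarrow> real" where
  "fock_norm f = sqrt (LINT z|fock_measure. (cmod (f z))\<^sup>2)"

text \<open>Holomorphy on the whole of complex \<open>n\<close>-space: the real Frechet derivative exists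
  at every point and is complex linear.\<close>

definition entire_cvec :: "(complex ^ 'n \<Rightarrow> complex) \<Rightarrow> bool" where
  "entire_cvec f \<longleftrightarrow>
     (\<forall>z. \<exists>D. (f has_derivative D) (at z) \<and> (\<forall>c v. D (c *s v) = c * D v))"

text \<open>Elements of the Fock space are genuine functions rather than classes modulo null sets:
  a class contains at most one continuous function.\<close>

definition fock_space :: "(complex ^ 'n \<Rightarrow> complex) set" where
  "fock_space = {f \<in> fock_L2. entire_cvec f}"

text \<open>The orthogonal projection of \<open>g\<close>, meaningful for \<open>g \<in> fock_L2\<close>.\<close>

definition fock_proj :: "(complex ^ 'n \<Rightarrow> complex) \<Rightarrow> (complex ^ 'n \<Rightarrow> complex)" where
  "fock_proj g = (THE h. h \<in> fock_space \<and>
      (\<forall>k \<in> fock_space. fock_inner (\<lambda>z. g z - h z) k = 0))"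

definition toeplitz ::
  "(complex ^ 'n \<Rightarrow> complex) \<Rightarrow> (complex ^ 'n \<Rightarrow> complex) \<Rightarrow> (complex ^ 'n \<Rightarrow> complex)" where
  "toeplitz a f = fock_proj (\<lambda>z. a z * f z)"

text \<open>Operators are maps on all functions of which only the restriction to
  \<open>fock_space\<close> matters.\<close>

definition fock_bounded_operator ::
  "((complex ^ 'n \<Rightarrow> complex) \<Rightarrow> (complex ^ 'n \<Rightarrow> complex)) \<Rightarrow> bool" where
  "fock_bounded_operator S \<longleftrightarrow>
     (\<forall>f \<in> fock_space. S f \<in> fock_space) \<and>
     (\<forall>f \<in> fock_space. \<forall>g \<in> fock_space. S (\<lambda>z. f z + g z) = (\<lambda>z. S f z + S g z)) \<and>
     (\<forall>c. \<forall>f \<in> fock_space. S (\<lambda>z. c * f z) = (\<lambda>z. c * S f z)) \<and>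
     (\<exists>C. \<forall>f \<in> fock_space. fock_norm (S f) \<le> C * fock_norm f)"

definition fock_SOT_converges ::
  "(nat \<Rightarrow> (complex ^ 'n \<Rightarrow> complex) \<Rightarrow> (complex ^ 'n \<Rightarrow> complex)) \<Rightarrow>
   ((complex ^ 'n \<Rightarrow> complex) \<Rightarrow> (complex ^ 'n \<Rightarrow> complex)) \<Rightarrow> bool" where
  "fock_SOT_converges T S \<longleftrightarrow>
     (\<forall>f \<in> fock_space. (\<lambda>k. fock_norm (\<lambda>z. T k f z - S f z)) \<longlonglongrightarrow> 0)"

end

theory Submission
  imports Defs "HOL-Probability.Distributions" "HOL-Complex_Analysis.Cauchy_Integral_Formula"
    "HOL-Real_Asymp.Real_Asymp"
begin

text \<open>
  Let \<open>K_w\<close> be the reproducing kernel. For fixed \<open>v\<close>, \<open>w\<close> and small \<open>t > 0\<close> the symbol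
  \<open>t^{-n} exp (pi |z|^2 - (pi/t) (z - v) \<cdot> cnj (z - w))\<close> is bounded and uniformly continuous, and a
  Gaussian integral shows that its Toeplitz operator is \<open>f \<mapsto> K_w(q) f(v + t q)\<close>. As \<open>t \<rightarrow> 0\<close> this
  converges in Hilbert-Schmidt norm to the rank one operator \<open>f \<mapsto> f(v) K_w\<close>, so every linear
  combination of such rank one operators is a norm limit of Toeplitz operators. Riemann sums for
  \<open>f = \<integral> f(z) K_z d\<lambda>(z)\<close> give uniformly bounded operators \<open>Q_m\<close> of this kind with \<open>Q_m \<rightarrow> 1\<close> strongly.
  Hence \<open>Q_m S Q_m \<rightarrow> S\<close> strongly, and \<open>Q_m S Q_m\<close> is again a combination of such rank one operators.
\<close>

text \<open>A Toeplitz operator pairs \<open>f\<close> and \<open>g\<close> through their values at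
  one common point, while the rank one operator pairs \<open>f v\<close> with the conjugate of
  \<open>g w\<close>. The obstacle is to separate the two points by a mere multiplication, and the
  complex exponent of the symbol does this because it treats the holomorphic \<open>f\<close> and
  the antiholomorphic conjugate of \<open>g\<close> differently. Compression on both sides is
  essential: S Q_m still contains the vectors S K_p and Q_m S the functionals f -> (S f)(p), whereas
  Q_m S Q_m involves \<open>S\<close> only through finitely many numbers. For each m the symbol
  approximates in operator norm, so its own sup norm may grow with m without harm. Since
  \<open>fock_proj\<close> is a definite description, a Toeplitz operator can be computed only by
  exhibiting its value. The value is recognized by pairing with kernels alone, and the quadrature
  operators that approximate the identity also supply the density of the kernels that this
  requires.\<close>

section \<open>Lebesgue measure under isometries, and Gaussian integrals\<close>

lemma nn_integral_lborel_translate: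
  fixes h :: "'a::euclidean_space \<Rightarrow> ennreal"
  assumes [measurable]: "h \<in> borel_measurable borel"
  shows "(\<integral>\<^sup>+x. h (c + x) \<partial>lborel) = (\<integral>\<^sup>+x. h x \<partial>lborel)"
proof -
  have "(\<integral>\<^sup>+x. h x \<partial>lborel) = (\<integral>\<^sup>+x. h x \<partial>distr lborel borel ((+) c))"
    by (simp add: lborel_distr_plus)
  then show ?thesis by (simp add: nn_integral_distr)
qed

lemma nn_integral_lborel_reflect:
  fixes h :: "'a::euclidean_space \<Rightarrow> ennreal"
  assumes [measurable]: "h \<in> borel_measurable borel"
  shows "(\<integral>\<^sup>+x. h (c - x) \<partial>lborel) = (\<integral>\<^sup>+x. h x \<partial>lborel)"
proof -
  have "distr lborel borel (\<lambda>x. c - x) = (lborel :: 'a measure)"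
    using lborel_affine[of "-1" c] by (simp add: density_1)
  then have "(\<integral>\<^sup>+x. h x \<partial>lborel) = (\<integral>\<^sup>+x. h x \<partial>distr lborel borel (\<lambda>x. c - x))"
    by simp
  then show ?thesis by (simp add: nn_integral_distr)
qed

text \<open>Uniqueness of Haar measure: Fubini compares any two translation invariant measures up to a
  factor, and the unit ball, which an isometry preserves, shows that the factor is one.\<close>

lemma lborel_distr_orthogonal_transformation:
  fixes f :: "'a::euclidean_space \<Rightarrow> 'a"
  assumes "orthogonal_transformation f"
  shows "distr lborel borel f = lborel"
proof (rule measure_eqI)
  have lin: "linear f" using assms by (rule orthogonal_transformation_linear)
  have [measurable]: "f \<in> borel_measurable borel"
    using lin by (intro borel_measurable_continuous_onI linear_continuous_on linear_conv_bounded_linear[THEN iffD1])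
  define g :: "'a \<Rightarrow> ennreal" where "g = indicator (ball 0 1)"
  have [measurable]: "g \<in> borel_measurable borel" unfolding g_def by (intro borel_measurable_indicator) simp
  have g_f: "g (f x) = g x" for x
    using assms by (simp add: g_def indicator_def orthogonal_transformation_norm)
  have g_pos: "(\<integral>\<^sup>+x. g x \<partial>lborel) \<noteq> 0"
    using content_ball_pos[of 1 "0::'a"] by (auto simp add: g_def measure_def zero_less_iff_neq_zero)
  have g_fin: "(\<integral>\<^sup>+x. g x \<partial>lborel) \<noteq> top"
    using emeasure_lborel_ball_finite[of "0::'a" 1] by (simp add: g_def)
  fix A :: "'a set" assume "A \<in> sets (distr lborel borel f)"
  then have [measurable]: "A \<in> sets borel" by simp
  define u :: "'a \<Rightarrow> ennreal" where "u = indicator A"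
  have [measurable]: "u \<in> borel_measurable borel" unfolding u_def by measurable
  \<comment> \<open>Surjectivity writes \<open>y\<close> as an image under \<open>f\<close>, so that
    a shift by \<open>y\<close> after \<open>f\<close> is a translation of the variable
    \<open>x\<close>.\<close>
  have shift: "(\<integral>\<^sup>+x. u (f x) * g (y + f x) \<partial>lborel) = (\<integral>\<^sup>+x. u (f x - y) * g (f x) \<partial>lborel)" for y
  proof -
    obtain y' where y': "y = f y'"
      using orthogonal_transformation_surj[OF assms] by (metis surjE)
    have "(\<integral>\<^sup>+x. u (f x - y) * g (f x) \<partial>lborel) = (\<integral>\<^sup>+x. u (f (y' + x) - y) * g (f (y' + x)) \<partial>lborel)"
      by (rule nn_integral_lborel_translate[symmetric]) measurable
    then show ?thesis by (simp add: linear_add[OF lin] y')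
  qed
  have "(\<integral>\<^sup>+x. u (f x) \<partial>lborel) * (\<integral>\<^sup>+y. g y \<partial>lborel) = (\<integral>\<^sup>+x. \<integral>\<^sup>+y. u (f x) * g y \<partial>lborel \<partial>lborel)"
    by (simp add: nn_integral_cmult nn_integral_multc)
  also have "\<dots> = (\<integral>\<^sup>+x. \<integral>\<^sup>+y. u (f x) * g (y + f x) \<partial>lborel \<partial>lborel)"
    by (simp add: nn_integral_cmult add.commute[of _ "f _"] nn_integral_lborel_translate)
  also have "\<dots> = (\<integral>\<^sup>+y. \<integral>\<^sup>+x. u (f x) * g (y + f x) \<partial>lborel \<partial>lborel)"
    by (rule lborel_pair.Fubini') measurable
  also have "\<dots> = (\<integral>\<^sup>+y. \<integral>\<^sup>+x. u (f x - y) * g (f x) \<partial>lborel \<partial>lborel)"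
    by (simp add: shift)
  also have "\<dots> = (\<integral>\<^sup>+x. \<integral>\<^sup>+y. u (f x - y) * g (f x) \<partial>lborel \<partial>lborel)"
    by (rule lborel_pair.Fubini') measurable
  also have "\<dots> = (\<integral>\<^sup>+x. u x \<partial>lborel) * (\<integral>\<^sup>+y. g y \<partial>lborel)"
    by (simp add: nn_integral_multc nn_integral_cmult nn_integral_lborel_reflect g_f)
  finally have "(\<integral>\<^sup>+x. u (f x) \<partial>lborel) = (\<integral>\<^sup>+x. u x \<partial>lborel)"
    using g_pos g_fin by (simp add: mult.commute[of _ "nn_integral lborel g"] ennreal_mult_cancel_left)
  moreover have "(\<integral>\<^sup>+x. u (f x) \<partial>lborel) = (\<integral>\<^sup>+x. u x \<partial>distr lborel borel f)"
    by (simp add: nn_integral_distr)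
  ultimately show "emeasure (distr lborel borel f) A = emeasure lborel A"
    by (simp add: u_def)
qed simp

lemma has_bochner_integral_exp_norm_sq:
  fixes a :: real
  assumes "a > 0"
  shows "has_bochner_integral lborel (\<lambda>x::'a::euclidean_space. exp (- a * (norm x)\<^sup>2)) (sqrt (pi / a) ^ DIM('a))"
proof (rule has_bochner_integral_nn_integral)
  \<comment> \<open>The standard deviation for which the normal density has exponent - a
    x^2.\<close>
  define s where "s = sqrt (1 / (2 * a))"
  have s: "s > 0" "2 * s\<^sup>2 = 1 / a" using assms by (auto simp: s_def)
  have "has_bochner_integral lborel (\<lambda>x. sqrt (2 * pi * s\<^sup>2) * normal_density 0 s x) (sqrt (2 * pi * s\<^sup>2) * 1)"
    using s by (intro has_bochner_integral_mult_right)
      (simp add: has_bochner_integral_iff integrable_normal_density integral_normal_density)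
  moreover have "2 * pi * s\<^sup>2 = pi / a"
    using arg_cong[OF s(2), of "\<lambda>x. pi * x"] by (simp add: mult_ac)
  ultimately have "has_bochner_integral lborel (\<lambda>x::real. exp (- a * x\<^sup>2)) (sqrt (pi / a))"
    using s assms by (simp add: normal_density_def mult.commute)
  then have 1: "(\<integral>\<^sup>+x. ennreal (exp (- a * x\<^sup>2)) \<partial>lborel) = ennreal (sqrt (pi / a))"
    by (simp add: has_bochner_integral_iff nn_integral_eq_integral)
  have "(norm x)\<^sup>2 = (\<Sum>b\<in>Basis. (x \<bullet> b)\<^sup>2)" for x :: 'a
    unfolding power2_norm_eq_inner by (subst euclidean_inner) (simp add: power2_eq_square)
  then have "exp (- a * (norm x)\<^sup>2) = (\<Prod>b\<in>Basis. exp (- a * (x \<bullet> b)\<^sup>2))" for x :: 'a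
    by (simp add: exp_sum[symmetric] sum_distrib_left)
  then have "(\<integral>\<^sup>+(x::'a). ennreal (exp (- a * (norm x)\<^sup>2)) \<partial>lborel) =
      (\<integral>\<^sup>+(x::'a). (\<Prod>b\<in>Basis. ennreal (exp (- a * (x \<bullet> b)\<^sup>2))) \<partial>lborel)"
    by (simp add: prod_ennreal)
  also have "\<dots> = (\<Prod>b\<in>(Basis::'a set). (\<integral>\<^sup>+x. ennreal (exp (- a * x\<^sup>2)) \<partial>lborel))"
    by (rule nn_integral_lborel_prod) auto
  also have "\<dots> = ennreal (sqrt (pi / a) ^ DIM('a))"
    using assms unfolding 1 by (simp add: ennreal_power)
  finally show "(\<integral>\<^sup>+(x::'a). ennreal (exp (- a * (norm x)\<^sup>2)) \<partial>lborel) = ennreal (sqrt (pi / a) ^ DIM('a))" .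
qed (use assms in auto)

lemma integrable_exp_norm_quadratic:
  fixes a b :: real
  assumes "a > 0"
  shows "integrable lborel (\<lambda>x::'a::euclidean_space. exp (b * norm x - a * (norm x)\<^sup>2))"
proof (rule Bochner_Integration.integrable_bound)
  \<comment> \<open>Half of the Gaussian decay is given up to absorb the linear term, by completing
    the square.\<close>
  show "integrable lborel (\<lambda>x::'a. exp (b\<^sup>2 / (2 * a)) * exp (- (a / 2) * (norm x)\<^sup>2))"
    using assms by (intro integrable_mult_right integrable.intros[OF has_bochner_integral_exp_norm_sq]) auto
  show "AE x::'a in lborel. norm (exp (b * norm x - a * (norm x)\<^sup>2)) \<le>
      norm (exp (b\<^sup>2 / (2 * a)) * exp (- (a / 2) * (norm x)\<^sup>2))"
  proof (rule AE_I2)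
    fix x :: 'a
    have "0 \<le> (b - a * norm x)\<^sup>2 / (2 * a)" using assms by simp
    also have "\<dots> = b\<^sup>2 / (2 * a) - b * norm x + a / 2 * (norm x)\<^sup>2"
      using assms by (simp add: field_simps power2_eq_square)
    finally show "norm (exp (b * norm x - a * (norm x)\<^sup>2)) \<le>
        norm (exp (b\<^sup>2 / (2 * a)) * exp (- (a / 2) * (norm x)\<^sup>2))"
      by (simp add: exp_add[symmetric])
  qed
qed auto

section \<open>The Hermitian form\<close>

text \<open>The library's real inner product is only the real part of this form. The exponents have
  to be holomorphic in the first argument, which forces the complex form.\<close>

definition cdot :: "complex ^ 'n \<Rightarrow> complex ^ 'n \<Rightarrow> complex" where
  "cdot z w = (\<Sum>i\<in>UNIV. z $ i * cnj (w $ i))"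

lemma cdot_add_left: "cdot (x + y) w = cdot x w + cdot y w"
  by (simp add: cdot_def sum.distrib algebra_simps)

lemma cdot_diff_left: "cdot (x - y) w = cdot x w - cdot y w"
  by (simp add: cdot_def sum_subtractf algebra_simps)

lemma cdot_add_right: "cdot x (v + w) = cdot x v + cdot x w"
  by (simp add: cdot_def sum.distrib algebra_simps)

lemma cdot_diff_right: "cdot x (v - w) = cdot x v - cdot x w"
  by (simp add: cdot_def sum_subtractf algebra_simps)

lemma cdot_scale_left: "cdot (c *s x) w = c * cdot x w"
  by (simp add: cdot_def sum_distrib_left algebra_simps)

lemma cdot_scaleR_left: "cdot (r *\<^sub>R x) w = of_real r * cdot x w"
  by (simp add: cdot_def sum_distrib_left scaleR_conv_of_real[where 'a=complex] algebra_simps)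

lemma cdot_zero_left [simp]: "cdot 0 w = 0"
  by (simp add: cdot_def)

lemma cdot_zero_right [simp]: "cdot z 0 = 0"
  by (simp add: cdot_def)

lemma cnj_cdot: "cnj (cdot z w) = cdot w z"
  by (simp add: cdot_def mult.commute)

lemma Re_cdot: "Re (cdot z w) = z \<bullet> w"
  by (simp add: cdot_def inner_vec_def inner_complex_def)

lemma cdot_self: "cdot z z = of_real ((norm z)\<^sup>2)"
proof (rule complex_eqI)
  have "Im (cdot z z) = - Im (cdot z z)"
    by (metis cnj_cdot cnj.sel(2))
  then show "Im (cdot z z) = Im (of_real ((norm z)\<^sup>2))" by simp
qed (simp add: Re_cdot power2_norm_eq_inner)

lemma bounded_linear_cdot: "bounded_linear (\<lambda>z. cdot z w)"
  by (intro linear_conv_bounded_linear[THEN iffD1] linearI)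
    (simp_all add: cdot_add_left cdot_scaleR_left scaleR_conv_of_real[where 'a=complex])

lemma continuous_on_cdot [continuous_intros]:
  assumes "continuous_on A f" "continuous_on A g"
  shows "continuous_on A (\<lambda>x. cdot (f x) (g x))"
  unfolding cdot_def by (intro continuous_intros assms)

subsection \<open>Entire functions\<close>

lemma entire_cvecI:
  assumes "\<And>z. (f has_derivative D z) (at z)" "\<And>z c v. D z (c *s v) = c * D z v"
  shows "entire_cvec f"
  using assms unfolding entire_cvec_def by blast

lemma entire_cvecE:
  assumes "entire_cvec f"
  obtains D where "\<And>z. (f has_derivative D z) (at z)" "\<And>z c v. D z (c *s v) = c * D z v"
  using assms unfolding entire_cvec_def by metis

lemma entire_cvec_const: "entire_cvec (\<lambda>z. c)"
  by (rule entire_cvecI[where D = "\<lambda>_ _. 0"]) auto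

lemma entire_cvec_add:
  assumes "entire_cvec f" "entire_cvec g"
  shows "entire_cvec (\<lambda>z. f z + g z)"
proof -
  obtain D E where "\<And>z. (f has_derivative D z) (at z)" "\<And>z c v. D z (c *s v) = c * D z v"
    "\<And>z. (g has_derivative E z) (at z)" "\<And>z c v. E z (c *s v) = c * E z v"
    using assms by (auto elim!: entire_cvecE)
  then show ?thesis
    by (intro entire_cvecI[where D = "\<lambda>z v. D z v + E z v"] has_derivative_add)
      (auto simp: algebra_simps)
qed

lemma entire_cvec_mult:
  assumes "entire_cvec f" "entire_cvec g"
  shows "entire_cvec (\<lambda>z. f z * g z)"
proof -
  obtain D E where "\<And>z. (f has_derivative D z) (at z)" "\<And>z c v. D z (c *s v) = c * D z v"
    "\<And>z. (g has_derivative E z) (at z)" "\<And>z c v. E z (c *s v) = c * E z v"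
    using assms by (auto elim!: entire_cvecE)
  then show ?thesis
    by (intro entire_cvecI[where D = "\<lambda>z v. f z * E z v + D z v * g z"] has_derivative_mult)
      (auto simp: algebra_simps)
qed

lemma entire_cvec_affine:
  assumes "entire_cvec f"
  shows "entire_cvec (\<lambda>z. f (v + t *\<^sub>R z))"
proof -
  obtain D where D: "\<And>z. (f has_derivative D z) (at z)" "\<And>z c v. D z (c *s v) = c * D z v"
    using entire_cvecE[OF assms] by blast
  show ?thesis
  proof (rule entire_cvecI[where D = "\<lambda>z h. D (v + t *\<^sub>R z) (t *\<^sub>R h)"])
    show "((\<lambda>z. f (v + t *\<^sub>R z)) has_derivative (\<lambda>h. D (v + t *\<^sub>R z) (t *\<^sub>R h))) (at z)" for z
      by (rule has_derivative_compose[OF _ D(1)]) (auto intro!: derivative_eq_intros)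
    have "t *\<^sub>R (c *s h) = c *s (t *\<^sub>R h)" for c and h :: "complex^'a"
      by (simp add: vec_eq_iff)
    then show "D (v + t *\<^sub>R z) (t *\<^sub>R (c *s h)) = c * D (v + t *\<^sub>R z) (t *\<^sub>R h)" for z c h
      by (simp only: D(2))
  qed
qed

lemma entire_cvec_exp_cdot: "entire_cvec (\<lambda>z. exp (c * cdot z w))"
proof (rule entire_cvecI[where D = "\<lambda>z h. exp (c * cdot z w) * (c * cdot h w)"])
  fix z
  have "((\<lambda>z. c * cdot z w) has_derivative (\<lambda>h. c * cdot h w)) (at z)"
    by (intro has_derivative_mult_right bounded_linear.has_derivative[OF bounded_linear_cdot]
        has_derivative_ident)
  from has_derivative_compose[OF this DERIV_exp[unfolded has_field_derivative_def]]
  show "((\<lambda>z. exp (c * cdot z w)) has_derivative (\<lambda>h. exp (c * cdot z w) * (c * cdot h w))) (at z)"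
    by simp
qed (simp add: cdot_scale_left)

lemma entire_cvec_continuous_on:
  assumes "entire_cvec f"
  shows "continuous_on A f"
  using assms unfolding entire_cvec_def
  by (meson continuous_at_imp_continuous_on has_derivative_continuous)

lemma entire_cvec_measurable:
  assumes "entire_cvec f"
  shows "f \<in> borel_measurable borel"
  using assms by (intro borel_measurable_continuous_onI entire_cvec_continuous_on)

text \<open>The passage to one complex variable: an orbit of the circle action is a circle on a
  complex line through 0, where Cauchy's formula applies.\<close>

lemma entire_cvec_holomorphic_line:
  assumes "entire_cvec g"
  shows "(\<lambda>c. g (c *s u)) holomorphic_on A"
proof -
  obtain D where D: "\<And>z. (g has_derivative D z) (at z)" "\<And>z c v. D z (c *s v) = c * D z v"
    using entire_cvecE[OF assms] by blast
  have "linear (\<lambda>c::complex. c *s u)"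
    by (rule linearI) (simp_all add: vec_eq_iff algebra_simps)
  then have lin: "((\<lambda>c::complex. c *s u) has_derivative (\<lambda>c. c *s u)) (at c)" for c
    by (intro bounded_linear.has_derivative[of "\<lambda>c. c *s u"] has_derivative_ident)
       (simp add: linear_conv_bounded_linear)
  have "((\<lambda>c. g (c *s u)) has_field_derivative D (c *s u) u) (at c)" for c
    using has_derivative_compose[OF lin D(1)] unfolding has_field_derivative_def D(2)
    by (simp add: mult_commute_abs)
  then show ?thesis
    by (meson holomorphic_onI field_differentiable_at_within field_differentiable_def)
qed

section \<open>Mean values of entire functions\<close>

text \<open>On the unit circle du / u = 2 pi i dt, so Cauchy's formula at the centre is an average
  over \<open>t\<close>. The indicator puts this average on \<open>lborel\<close>, ready for
  Fubini.\<close>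

lemma holomorphic_circle_mean:
  assumes "G holomorphic_on UNIV"
  shows "(LINT t|lborel. indicator {0..1} t *\<^sub>R G (cis (2 * pi * t))) = G 0"
proof -
  have "((\<lambda>u. G u / (u - 0)) has_contour_integral (2 * of_real pi * \<i> * G 0)) (circlepath 0 1)"
    using assms by (intro Cauchy_integral_circlepath_simple) (auto intro: holomorphic_on_subset)
  then have "((\<lambda>t. 2 * of_real pi * \<i> * G (cis (2 * pi * t))) has_integral (2 * of_real pi * \<i> * G 0)) {0..1}"
    unfolding has_contour_integral_def
    by (rule has_integral_eq[rotated])
      (simp add: vector_derivative_circlepath01, simp add: circlepath cis_conv_exp mult_ac)
  then have 1: "((\<lambda>t. G (cis (2 * pi * t))) has_integral G 0) {0..1}"
    by (drule_tac has_integral_divide[where c = "2 * of_real pi * \<i>"]) simp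
  have "continuous_on {0..1} (\<lambda>t. G (cis (2 * pi * t)))"
    using holomorphic_on_imp_continuous_on[OF assms]
    by (rule continuous_on_compose2) (auto intro!: continuous_intros)
  then have "set_integrable lborel {0..1} (\<lambda>t. G (cis (2 * pi * t)))"
    by (rule borel_integrable_atLeastAtMost')
  from set_borel_integral_eq_integral(2)[OF this] 1 show ?thesis
    by (simp add: set_lebesgue_integral_def integral_unique)
qed

lemma orthogonal_transformation_scale_unit:
  assumes "cmod c = 1"
  shows "orthogonal_transformation (\<lambda>u::complex^'n. c *s u)"
  unfolding orthogonal_transformation
proof (intro conjI allI linearI)
  fix u :: "complex^'n"
  show "norm (c *s u) = norm u"
    using assms by (simp add: norm_vec_def norm_mult)
qed (simp_all add: vec_eq_iff algebra_simps)

text \<open>Averaging over the circle action reduces the integral to the mean value property in one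
  variable.\<close>

lemma entire_cvec_gaussian_mean:
  fixes g :: "complex ^ 'n \<Rightarrow> complex"
  assumes ent: "entire_cvec g" and "a > 0"
    and int: "integrable lborel (\<lambda>u. exp (- a * (norm u)\<^sup>2) *\<^sub>R g u)"
  shows "(LINT u|lborel. exp (- a * (norm u)\<^sup>2) *\<^sub>R g u) =
    (pi / a) ^ CARD('n) *\<^sub>R g 0"
proof -
  define h where "h u = exp (- a * (norm u)\<^sup>2) *\<^sub>R g u" for u
  define R where "R t = (\<lambda>u::complex^'n. cis (2 * pi * t) *s u)" for t
  \<comment> \<open>Integrating \<open>F\<close> over \<open>u\<close> first gives the integral of
    \<open>h\<close> for each \<open>t\<close> in the unit interval, as rotations preserve Lebesgue
    measure. Integrating over \<open>t\<close> first averages \<open>g\<close> on circles, because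
    the weight is rotation invariant.\<close>
  define F where "F t u = indicator {0..1::real} t *\<^sub>R h (R t u)" for t u
  have orth: "orthogonal_transformation (R t)" for t
    unfolding R_def by (rule orthogonal_transformation_scale_unit) simp
  have R_meas: "R t \<in> borel_measurable borel" for t
    using orthogonal_transformation_linear[OF orth]
    by (intro borel_measurable_continuous_onI linear_continuous_on linear_conv_bounded_linear[THEN iffD1])
  have g_cont: "continuous_on UNIV g"
    using ent by (rule entire_cvec_continuous_on)
  have h_meas[measurable]: "h \<in> borel_measurable borel"
    unfolding h_def by (intro borel_measurable_continuous_onI continuous_intros g_cont)
  have hR_int: "integrable lborel (\<lambda>u. h (R t u))" for t
    using int integrable_distr_eq[of "R t" lborel borel h] R_meas[of t]
    by (simp add: lborel_distr_orthogonal_transformation[OF orth] h_def[abs_def])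
  have hR: "(LINT u|lborel. h (R t u)) = (LINT u|lborel. h u)" for t
    using integral_distr[of "R t" lborel borel h] R_meas[of t]
    by (simp add: lborel_distr_orthogonal_transformation[OF orth])
  have hR_norm: "(LINT u|lborel. cmod (h (R t u))) = (LINT u|lborel. cmod (h u))" for t
    using integral_distr[of "R t" lborel borel "\<lambda>u. cmod (h u)"] R_meas[of t]
    by (simp add: lborel_distr_orthogonal_transformation[OF orth])
  have "continuous_on UNIV (\<lambda>p::real \<times> (complex^'n). cis (2 * pi * fst p) *s snd p)"
    unfolding vector_scalar_mult_def by (intro continuous_intros)
  then have RR: "(\<lambda>p::real \<times> (complex^'n). R (fst p) (snd p)) \<in> borel_measurable borel"
    unfolding R_def by (rule borel_measurable_continuous_onI)
  have "(\<lambda>p. h (R (fst p) (snd p))) \<in> borel_measurable (borel \<Otimes>\<^sub>M borel)"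
    unfolding borel_prod by (rule measurable_compose[OF RR h_meas])
  then have F_meas: "case_prod F \<in> borel_measurable (lborel \<Otimes>\<^sub>M lborel)"
    unfolding F_def case_prod_beta by measurable
  have F_int: "integrable (lborel \<Otimes>\<^sub>M lborel) (case_prod F)"
  proof (rule lborel_pair.Fubini_integrable[OF F_meas])
    have "integrable lborel (\<lambda>t. indicator {0..1::real} t *\<^sub>R (LINT u|lborel. cmod (h u)))"
      by (intro integrable_scaleR_left integrable_real_indicator) (auto simp: emeasure_lborel_Icc_eq)
    then show "integrable lborel (\<lambda>t. LINT u|lborel. norm (case (t, u) of (t, u) \<Rightarrow> F t u))"
      by (simp add: F_def hR_norm)
    show "AE t in lborel. integrable lborel (\<lambda>u. case (t, u) of (t, u) \<Rightarrow> F t u)"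
      using hR_int by (simp add: F_def)
  qed
  have inner: "(LINT t|lborel. F t u) = exp (- a * (norm u)\<^sup>2) *\<^sub>R g 0" for u
  proof -
    have "F t u = exp (- a * (norm u)\<^sup>2) *\<^sub>R (indicator {0..1} t *\<^sub>R g (cis (2 * pi * t) *s u))" for t
      using orthogonal_transformation_norm[OF orth, of t u] by (simp add: F_def h_def R_def)
    then show ?thesis
      using holomorphic_circle_mean[OF entire_cvec_holomorphic_line[OF ent, of u]]
      by (simp del: scaleR_scaleR)
  qed
  have "(LINT u|lborel. LINT t|lborel. F t u) = (LINT t|lborel. LINT u|lborel. F t u)"
    by (rule lborel_pair.Fubini_integral[OF F_int])
  also have "\<dots> = (LINT u|lborel. h u)"
    by (simp add: F_def hR)
  finally have "(LINT u|lborel. h u) = (LINT u|lborel. exp (- a * (norm (u :: complex ^ 'n))\<^sup>2)) *\<^sub>R g 0"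
    using integrable.intros[OF has_bochner_integral_exp_norm_sq[where 'a = "complex ^ 'n", OF \<open>a > 0\<close>]]
    by (simp add: inner)
  \<comment> \<open>The real dimension is twice \<open>CARD('n)\<close>, which removes the square
    root.\<close>
  also have "(LINT u|lborel. exp (- a * (norm (u :: complex ^ 'n))\<^sup>2)) = (pi / a) ^ CARD('n)"
    using has_bochner_integral_exp_norm_sq[OF \<open>a > 0\<close>, where 'a = "complex ^ 'n"] \<open>a > 0\<close>
    by (simp add: has_bochner_integral_iff power_mult mult.commute power2_eq_square power_mult_distrib[symmetric])
  finally show ?thesis
    by (simp add: h_def)
qed

lemma borel_measurable_cnj [measurable (raw)]:
  assumes "f \<in> borel_measurable M"
  shows "(\<lambda>x. cnj (f x)) \<in> borel_measurable M"
  by (rule borel_measurable_continuous_on[OF _ assms]) (intro continuous_intros)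

subsection \<open>The Gaussian L2 space\<close>

lemma sets_fock_measure [measurable_cong, simp]: "sets fock_measure = sets borel"
  by (simp add: fock_measure_def)

lemma space_fock_measure [simp]: "space fock_measure = UNIV"
  by (simp add: fock_measure_def)

lemma borel_measurable_fock [simp]: "borel_measurable fock_measure = borel_measurable borel"
  by (rule measurable_cong_sets) simp_all

lemma integrable_fock_measure_iff:
  fixes f :: "complex ^ 'n \<Rightarrow> 'b::{banach, second_countable_topology}"
  assumes "f \<in> borel_measurable borel"
  shows "integrable fock_measure f \<longleftrightarrow> integrable lborel (\<lambda>z. exp (- pi * (norm z)\<^sup>2) *\<^sub>R f z)"
  unfolding fock_measure_def using assms by (intro integrable_density) auto

lemma integral_fock_measure:
  fixes f :: "complex ^ 'n \<Rightarrow> 'b::{banach, second_countable_topology}"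
  assumes "f \<in> borel_measurable borel"
  shows "(LINT z|fock_measure. f z) = (LINT z|lborel. exp (- pi * (norm z)\<^sup>2) *\<^sub>R f z)"
  unfolding fock_measure_def using assms by (intro integral_density) auto

lemma integrable_fock_bound:
  fixes f :: "complex ^ 'n \<Rightarrow> 'b::{banach, second_countable_topology}"
  assumes "f \<in> borel_measurable borel" "a < pi"
    and bound: "\<And>z. norm (f z) \<le> C * exp (b * norm z + a * (norm z)\<^sup>2)"
  shows "integrable fock_measure f"
proof -
  have "integrable lborel (\<lambda>z. exp (- pi * (norm z)\<^sup>2) *\<^sub>R f z)"
  proof (rule Bochner_Integration.integrable_bound)
    show "integrable lborel (\<lambda>z::complex^'n. C * exp (b * norm z - (pi - a) * (norm z)\<^sup>2))"
      using assms(2) by (intro integrable_mult_right integrable_exp_norm_quadratic) auto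
    show "AE z in lborel. norm (exp (- pi * (norm z)\<^sup>2) *\<^sub>R f z) \<le>
        norm (C * exp (b * norm z - (pi - a) * (norm z)\<^sup>2))"
    proof (rule AE_I2)
      fix z :: "complex ^ 'n"
      have "norm (exp (- pi * (norm z)\<^sup>2) *\<^sub>R f z) = exp (- pi * (norm z)\<^sup>2) * norm (f z)"
        by simp
      also have "\<dots> \<le> exp (- pi * (norm z)\<^sup>2) * (C * exp (b * norm z + a * (norm z)\<^sup>2))"
        by (intro mult_left_mono bound) simp
      also have "\<dots> = C * exp (b * norm z - (pi - a) * (norm z)\<^sup>2)"
        by (simp add: exp_add[symmetric] algebra_simps mult_exp_exp)
      finally show "norm (exp (- pi * (norm z)\<^sup>2) *\<^sub>R f z) \<le>
        norm (C * exp (b * norm z - (pi - a) * (norm z)\<^sup>2))"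
        by simp
    qed
  qed (use assms(1) in measurable)
  then show ?thesis
    by (simp add: integrable_fock_measure_iff assms(1))
qed

text \<open>The rate pi is the one for which the Gaussian has total mass one; this later bounds the
  sum of the quadrature weights.\<close>

lemma prob_space_fock_measure: "prob_space (fock_measure :: (complex ^ 'n) measure)"
proof
  have "emeasure fock_measure (UNIV :: (complex ^ 'n) set) =
      (\<integral>\<^sup>+(z::complex^'n). ennreal (exp (- pi * (norm z)\<^sup>2)) \<partial>lborel)"
    by (simp add: fock_measure_def emeasure_density)
  also have "\<dots> = 1"
    using has_bochner_integral_exp_norm_sq[of pi, where 'a = "complex ^ 'n"]
    by (simp add: has_bochner_integral_iff nn_integral_eq_integral)
  finally show "emeasure fock_measure (space fock_measure :: (complex ^ 'n) set) = 1"
    by simp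
qed

lemma fock_L2_iff:
  "f \<in> fock_L2 \<longleftrightarrow> f \<in> borel_measurable borel \<and> integrable fock_measure (\<lambda>z. (cmod (f z))\<^sup>2)"
  by (simp add: fock_L2_def)

lemma fock_L2_measurable [measurable_dest]: "f \<in> fock_L2 \<Longrightarrow> f \<in> borel_measurable borel"
  by (simp add: fock_L2_iff)

lemma fock_L2_mono:
  assumes "g \<in> fock_L2" "f \<in> borel_measurable borel" "\<And>z. cmod (f z) \<le> C * cmod (g z)"
  shows "f \<in> fock_L2"
  unfolding fock_L2_iff
proof
  show "integrable fock_measure (\<lambda>z. (cmod (f z))\<^sup>2)"
  proof (rule Bochner_Integration.integrable_bound)
    show "integrable fock_measure (\<lambda>z. C\<^sup>2 * (cmod (g z))\<^sup>2)"
      using assms(1) by (simp add: fock_L2_iff)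
    show "AE z in fock_measure. norm ((cmod (f z))\<^sup>2) \<le> norm (C\<^sup>2 * (cmod (g z))\<^sup>2)"
      using power_mono[OF assms(3), of _ 2] by (simp add: power_mult_distrib)
  qed (use assms(2) in simp)
qed fact

text \<open>Squaring doubles the quadratic rate, and the weight decays at rate pi: hence the
  threshold \<open>pi / 2\<close>.\<close>

lemma fock_L2_bound:
  assumes "f \<in> borel_measurable borel" "a < pi / 2"
    and bound: "\<And>z. cmod (f z) \<le> C * exp (b * norm z + a * (norm z)\<^sup>2)"
  shows "f \<in> fock_L2"
  unfolding fock_L2_iff
proof
  show "integrable fock_measure (\<lambda>z. (cmod (f z))\<^sup>2)"
  proof (rule integrable_fock_bound)
    fix z
    have "(cmod (f z))\<^sup>2 \<le> (C * exp (b * norm z + a * (norm z)\<^sup>2))\<^sup>2"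
      by (intro power_mono bound) simp
    also have "\<dots> = C\<^sup>2 * exp (2 * b * norm z + 2 * a * (norm z)\<^sup>2)"
      by (simp add: power_mult_distrib exp_double[symmetric] algebra_simps)
    finally show "norm ((cmod (f z))\<^sup>2) \<le> C\<^sup>2 * exp (2 * b * norm z + 2 * a * (norm z)\<^sup>2)"
      by simp
  qed (use assms in auto)
qed fact

lemma fock_L2_mult_integrable:
  assumes "f \<in> fock_L2" "g \<in> fock_L2"
  shows "integrable fock_measure (\<lambda>z. f z * cnj (g z))"
proof (rule Bochner_Integration.integrable_bound)
  show "integrable fock_measure (\<lambda>z. (cmod (f z))\<^sup>2 + (cmod (g z))\<^sup>2)"
    using assms by (simp add: fock_L2_iff)
  have "norm (f z * cnj (g z)) \<le> norm ((cmod (f z))\<^sup>2 + (cmod (g z))\<^sup>2)" for z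
  proof -
    have "0 \<le> (cmod (f z) - cmod (g z))\<^sup>2" by simp
    then have "2 * (cmod (f z) * cmod (g z)) \<le> (cmod (f z))\<^sup>2 + (cmod (g z))\<^sup>2"
      by (simp add: power2_diff)
    moreover have "0 \<le> cmod (f z) * cmod (g z)" by simp
    ultimately have "cmod (f z) * cmod (g z) \<le> (cmod (f z))\<^sup>2 + (cmod (g z))\<^sup>2"
      by linarith
    then show ?thesis by (simp add: norm_mult)
  qed
  then show "AE z in fock_measure. norm (f z * cnj (g z)) \<le> norm ((cmod (f z))\<^sup>2 + (cmod (g z))\<^sup>2)"
    by simp
qed (use assms in \<open>auto simp: fock_L2_iff\<close>)

lemma fock_L2_add:
  assumes f: "f \<in> fock_L2" and g: "g \<in> fock_L2"
  shows "(\<lambda>z. f z + g z) \<in> fock_L2"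
  unfolding fock_L2_iff
proof
  show "integrable fock_measure (\<lambda>z. (cmod (f z + g z))\<^sup>2)"
  proof (rule Bochner_Integration.integrable_bound)
    show "integrable fock_measure (\<lambda>z. 2 * ((cmod (f z))\<^sup>2 + (cmod (g z))\<^sup>2))"
      using assms by (simp add: fock_L2_iff)
    have "(cmod (f z + g z))\<^sup>2 \<le> 2 * ((cmod (f z))\<^sup>2 + (cmod (g z))\<^sup>2)" for z
    proof -
      have "(cmod (f z + g z))\<^sup>2 \<le> (cmod (f z) + cmod (g z))\<^sup>2"
        by (intro power_mono norm_triangle_ineq) simp
      moreover have "0 \<le> (cmod (f z) - cmod (g z))\<^sup>2" by simp
      ultimately show ?thesis by (simp add: power2_diff power2_sum)
    qed
    then show "AE z in fock_measure. norm ((cmod (f z + g z))\<^sup>2) \<le> norm (2 * ((cmod (f z))\<^sup>2 + (cmod (g z))\<^sup>2))"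
      by simp
  qed (use assms in \<open>auto simp: fock_L2_iff\<close>)
qed (use assms in \<open>auto simp: fock_L2_iff\<close>)

lemma fock_L2_cmult: "f \<in> fock_L2 \<Longrightarrow> (\<lambda>z. c * f z) \<in> fock_L2"
  by (rule fock_L2_mono[where C = "cmod c"]) (auto simp: fock_L2_iff norm_mult)

lemma fock_L2_diff:
  assumes "f \<in> fock_L2" "g \<in> fock_L2"
  shows "(\<lambda>z. f z - g z) \<in> fock_L2"
  using fock_L2_add[OF assms(1) fock_L2_cmult[OF assms(2), of "-1"]] by simp

lemma fock_inner_diff_left:
  assumes "f \<in> fock_L2" "g \<in> fock_L2" "k \<in> fock_L2"
  shows "fock_inner (\<lambda>z. f z - g z) k = fock_inner f k - fock_inner g k"
  using assms by (simp add: fock_inner_def left_diff_distrib fock_L2_mult_integrable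
      Bochner_Integration.integral_diff)

lemma fock_inner_add_left:
  assumes "f \<in> fock_L2" "g \<in> fock_L2" "k \<in> fock_L2"
  shows "fock_inner (\<lambda>z. f z + g z) k = fock_inner f k + fock_inner g k"
  using assms by (simp add: fock_inner_def distrib_right fock_L2_mult_integrable
      Bochner_Integration.integral_add)

lemma fock_inner_cmult_left: "fock_inner (\<lambda>z. c * f z) k = c * fock_inner f k"
  by (simp add: fock_inner_def mult.assoc)

lemma cnj_fock_inner: "cnj (fock_inner f g) = fock_inner g f"
  unfolding fock_inner_def by (subst Bochner_Integration.integral_cnj[symmetric]) (simp del: Bochner_Integration.integral_cnj add: mult.commute)

lemma fock_inner_sum_left:
  assumes "finite I" "\<And>i. i \<in> I \<Longrightarrow> f i \<in> fock_L2" "k \<in> fock_L2"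
  shows "fock_inner (\<lambda>z. \<Sum>i\<in>I. f i z) k = (\<Sum>i\<in>I. fock_inner (f i) k)"
  using assms by (simp add: fock_inner_def sum_distrib_right fock_L2_mult_integrable
      Bochner_Integration.integral_sum)

lemma fock_inner_add_right:
  assumes "f \<in> fock_L2" "g \<in> fock_L2" "k \<in> fock_L2"
  shows "fock_inner k (\<lambda>z. f z + g z) = fock_inner k f + fock_inner k g"
  by (subst cnj_fock_inner[symmetric]) (simp add: fock_inner_add_left[OF assms] cnj_fock_inner)

lemma fock_inner_diff_right:
  assumes "f \<in> fock_L2" "g \<in> fock_L2" "k \<in> fock_L2"
  shows "fock_inner k (\<lambda>z. f z - g z) = fock_inner k f - fock_inner k g"
  by (subst cnj_fock_inner[symmetric]) (simp add: fock_inner_diff_left[OF assms] cnj_fock_inner)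

lemma fock_inner_sum_right:
  assumes "finite I" "\<And>i. i \<in> I \<Longrightarrow> f i \<in> fock_L2" "k \<in> fock_L2"
  shows "fock_inner k (\<lambda>z. \<Sum>i\<in>I. f i z) = (\<Sum>i\<in>I. fock_inner k (f i))"
  by (subst cnj_fock_inner[symmetric]) (simp add: fock_inner_sum_left[OF assms] cnj_fock_inner)

lemma fock_inner_cmult_right: "fock_inner k (\<lambda>z. c * f z) = cnj c * fock_inner k f"
  by (subst cnj_fock_inner[symmetric]) (simp add: fock_inner_cmult_left cnj_fock_inner)

lemma fock_norm_nonneg [simp]: "0 \<le> fock_norm f"
  by (simp add: fock_norm_def)

lemma fock_norm_sq: "(fock_norm f)\<^sup>2 = (LINT z|fock_measure. (cmod (f z))\<^sup>2)"
  by (simp add: fock_norm_def)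

lemma fock_inner_self: "fock_inner f f = of_real ((fock_norm f)\<^sup>2)"
  unfolding fock_norm_sq fock_inner_def complex_norm_square[symmetric] of_real_power[symmetric]
  by (rule integral_complex_of_real)

lemma fock_norm_cmult: "fock_norm (\<lambda>z. c * f z) = cmod c * fock_norm f"
  by (simp add: fock_norm_def norm_mult power_mult_distrib real_sqrt_mult)

lemma fock_norm_mono:
  assumes "g \<in> fock_L2" "f \<in> fock_L2" "\<And>z. cmod (f z) \<le> cmod (g z)"
  shows "fock_norm f \<le> fock_norm g"
  unfolding fock_norm_def
  using assms by (intro real_sqrt_le_mono integral_mono power_mono) (auto simp: fock_L2_iff)

lemma fock_Cauchy_Schwarz:
  assumes f: "f \<in> fock_L2" and g: "g \<in> fock_L2"
  shows "cmod (fock_inner f g) \<le> fock_norm f * fock_norm g"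
proof -
  have [measurable]: "f \<in> borel_measurable borel" "g \<in> borel_measurable borel"
    using f g by (auto simp: fock_L2_iff)
  let ?I = "LINT z|fock_measure. cmod (f z) * cmod (g z)"
  have int: "integrable fock_measure (\<lambda>z. cmod (f z) * cmod (g z))"
    using integrable_norm[OF fock_L2_mult_integrable[OF f g]] by (simp add: norm_mult)
  have "(\<integral>\<^sup>+z. ennreal (cmod (f z)) * ennreal (cmod (g z)) \<partial>fock_measure)\<^sup>2 \<le>
      (\<integral>\<^sup>+z. (ennreal (cmod (f z)))\<^sup>2 \<partial>fock_measure) * (\<integral>\<^sup>+z. (ennreal (cmod (g z)))\<^sup>2 \<partial>fock_measure)"
    by (rule Cauchy_Schwarz_nn_integral) auto
  then have "ennreal (?I\<^sup>2) \<le> ennreal ((fock_norm f)\<^sup>2 * (fock_norm g)\<^sup>2)"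
    using f g int
    by (simp add: ennreal_power ennreal_mult[symmetric] nn_integral_eq_integral fock_L2_iff fock_norm_sq)
  then have "?I\<^sup>2 \<le> (fock_norm f * fock_norm g)\<^sup>2"
    by (simp add: power_mult_distrib)
  then have "?I \<le> fock_norm f * fock_norm g"
    by (rule power2_le_imp_le) simp
  moreover have "cmod (fock_inner f g) \<le> ?I"
    using integral_norm_bound[of fock_measure "\<lambda>z. f z * cnj (g z)"]
    by (simp add: fock_inner_def norm_mult)
  ultimately show ?thesis by linarith
qed

lemma fock_norm_triangle:
  assumes f: "f \<in> fock_L2" and g: "g \<in> fock_L2"
  shows "fock_norm (\<lambda>z. f z + g z) \<le> fock_norm f + fock_norm g"
proof (rule power2_le_imp_le)
  have "of_real ((fock_norm (\<lambda>z. f z + g z))\<^sup>2) =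
      fock_inner f f + fock_inner g g + (fock_inner f g + cnj (fock_inner f g))"
    unfolding fock_inner_self[symmetric] using f g
    by (simp add: fock_inner_add_left fock_inner_add_right fock_L2_add cnj_fock_inner)
  then have "complex_of_real ((fock_norm (\<lambda>z. f z + g z))\<^sup>2) =
      of_real ((fock_norm f)\<^sup>2 + (fock_norm g)\<^sup>2 + 2 * Re (fock_inner f g))"
    by (simp add: fock_inner_self complex_add_cnj)
  then have "(fock_norm (\<lambda>z. f z + g z))\<^sup>2 = (fock_norm f)\<^sup>2 + (fock_norm g)\<^sup>2 + 2 * Re (fock_inner f g)"
    by (simp only: of_real_eq_iff)
  also have "\<dots> \<le> (fock_norm f)\<^sup>2 + (fock_norm g)\<^sup>2 + 2 * (fock_norm f * fock_norm g)"
    using fock_Cauchy_Schwarz[OF f g] complex_Re_le_cmod[of "fock_inner f g"] by simp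
  finally show "(fock_norm (\<lambda>z. f z + g z))\<^sup>2 \<le> (fock_norm f + fock_norm g)\<^sup>2"
    by (simp add: power2_sum)
qed simp

text \<open>Membership and estimate share one induction, since the triangle inequality asks for the
  partial sum to be in \<open>fock_L2\<close>.\<close>

lemma fock_norm_sum_le:
  assumes "finite I" "\<And>i. i \<in> I \<Longrightarrow> f i \<in> fock_L2"
  shows "(\<lambda>z. \<Sum>i\<in>I. f i z) \<in> fock_L2 \<and> fock_norm (\<lambda>z. \<Sum>i\<in>I. f i z) \<le> (\<Sum>i\<in>I. fock_norm (f i))"
  using assms
proof (induction I)
  case empty
  then show ?case by (simp add: fock_norm_def fock_L2_iff)
next
  case (insert i I)
  then show ?case
    using fock_norm_triangle[of "f i" "\<lambda>z. \<Sum>i\<in>I. f i z"] fock_L2_add[of "f i" "\<lambda>z. \<Sum>i\<in>I. f i z"]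
    by fastforce
qed

subsection \<open>The Fock space and its reproducing kernel\<close>

lemma fock_space_iff: "f \<in> fock_space \<longleftrightarrow> f \<in> fock_L2 \<and> entire_cvec f"
  by (simp add: fock_space_def)

lemma fock_space_L2: "f \<in> fock_space \<Longrightarrow> f \<in> fock_L2"
  by (simp add: fock_space_iff)

lemma fock_space_cmult: "f \<in> fock_space \<Longrightarrow> (\<lambda>z. c * f z) \<in> fock_space"
  by (simp add: fock_space_iff fock_L2_cmult entire_cvec_mult entire_cvec_const)

lemma fock_space_add: "f \<in> fock_space \<Longrightarrow> g \<in> fock_space \<Longrightarrow> (\<lambda>z. f z + g z) \<in> fock_space"
  by (simp add: fock_space_iff fock_L2_add entire_cvec_add)

lemma fock_space_diff: "f \<in> fock_space \<Longrightarrow> g \<in> fock_space \<Longrightarrow> (\<lambda>z. f z - g z) \<in> fock_space"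
  using fock_space_add[of f "\<lambda>z. - 1 * g z"] fock_space_cmult[of g "-1"] by simp

lemma fock_space_zero: "(\<lambda>z. 0) \<in> fock_space"
  by (simp add: fock_space_iff fock_L2_iff entire_cvec_const)

lemma fock_space_sum:
  assumes "finite I" "\<And>i. i \<in> I \<Longrightarrow> f i \<in> fock_space"
  shows "(\<lambda>z. \<Sum>i\<in>I. f i z) \<in> fock_space"
  using assms by (induction I) (auto simp: fock_space_zero fock_space_add)

text \<open>The reproducing kernel K_q. The parameter comes first so that \<open>fock_ker q\<close>
  is itself an element of the Fock space.\<close>

definition fock_ker :: "complex ^ 'n \<Rightarrow> complex ^ 'n \<Rightarrow> complex" where
  "fock_ker q z = exp (of_real pi * cdot z q)"

lemma cmod_fock_ker: "cmod (fock_ker q z) = exp (pi * (z \<bullet> q))"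
  by (simp add: fock_ker_def Re_cdot)

lemma cmod_fock_ker_le: "cmod (fock_ker q z) \<le> exp (pi * norm q * norm z)"
  using norm_cauchy_schwarz[of z q] by (simp add: cmod_fock_ker mult.commute mult.left_commute)

lemma cnj_fock_ker: "cnj (fock_ker q z) = fock_ker z q"
  by (simp add: fock_ker_def exp_cnj cnj_cdot)

lemma fock_ker_space: "fock_ker q \<in> fock_space"
  unfolding fock_space_iff
proof
  show ent: "entire_cvec (fock_ker q)"
    unfolding fock_ker_def[abs_def] by (rule entire_cvec_exp_cdot)
  show "fock_ker q \<in> fock_L2"
    using cmod_fock_ker_le
    by (intro fock_L2_bound[where C = 1 and b = "pi * norm q" and a = 0] entire_cvec_measurable ent) auto
qed

lemmas fock_ker_L2 = fock_space_L2[OF fock_ker_space]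

lemma lborel_integral_translate:
  fixes h :: "'a::euclidean_space \<Rightarrow> 'b::{banach, second_countable_topology}"
  assumes "h \<in> borel_measurable borel"
  shows "(LINT x|lborel. h (c + x)) = (LINT x|lborel. h x)"
    and "integrable lborel (\<lambda>x. h (c + x)) \<longleftrightarrow> integrable lborel h"
proof -
  have "(LINT x|lborel. h x) = (LINT x|distr lborel borel ((+) c). h x)"
    "integrable lborel h \<longleftrightarrow> integrable (distr lborel borel ((+) c)) h"
    by (simp_all add: lborel_distr_plus)
  then show "(LINT x|lborel. h (c + x)) = (LINT x|lborel. h x)"
    "integrable lborel (\<lambda>x. h (c + x)) \<longleftrightarrow> integrable lborel h"
    using assms by (simp_all add: integral_distr integrable_distr_eq)
qed

text \<open>Both the reproducing formula and the formula for the Toeplitz operators below come from this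
  Gaussian integral: after translation to \<open>v\<close>, the part of the exponent that is linear in \<open>u\<close> is
  holomorphic and can be absorbed in the entire function.\<close>

lemma entire_cvec_gaussian_polarized:
  fixes f :: "complex ^ 'n \<Rightarrow> complex"
  assumes ent: "entire_cvec f" and "a > 0"
    and int: "integrable lborel (\<lambda>z. exp (- of_real a * cdot (z - v) (z - w)) * f z)"
  shows "(LINT z|lborel. exp (- of_real a * cdot (z - v) (z - w)) * f z) = of_real ((pi / a) ^ CARD('n)) * f v"
proof -
  let ?h = "\<lambda>z. exp (- of_real a * cdot (z - v) (z - w)) * f z"
  let ?g = "\<lambda>u. f (v + u) * exp ((- of_real a) * cdot u (v - w))"
  have "entire_cvec (\<lambda>u. f (v + 1 *\<^sub>R u))" by (rule entire_cvec_affine[OF ent])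
  then have g: "entire_cvec ?g"
    by (intro entire_cvec_mult entire_cvec_exp_cdot) simp
  have h: "?h \<in> borel_measurable borel"
    by (intro borel_measurable_continuous_onI continuous_intros entire_cvec_continuous_on[OF ent])
  have eq: "?h (v + u) = exp (- a * (norm u)\<^sup>2) *\<^sub>R ?g u" for u
  proof -
    have "- of_real a * cdot (v + u - v) (v + u - w) = of_real (- a * (norm u)\<^sup>2) + - of_real a * cdot u (v - w)"
      using cdot_add_right[of u u "v - w"] by (simp add: cdot_self algebra_simps)
    then have "exp (- of_real a * cdot (v + u - v) (v + u - w)) =
        of_real (exp (- a * (norm u)\<^sup>2)) * exp (- of_real a * cdot u (v - w))"
      by (simp only: exp_add exp_of_real)
    then show ?thesis by (simp add: scaleR_conv_of_real)
  qed
  have "(LINT z|lborel. ?h z) = (LINT u|lborel. exp (- a * (norm u)\<^sup>2) *\<^sub>R ?g u)"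
    using lborel_integral_translate(1)[OF h, of v] by (simp only: eq)
  also have "\<dots> = (pi / a) ^ CARD('n) *\<^sub>R ?g 0"
    using lborel_integral_translate(2)[OF h, of v] int
    by (intro entire_cvec_gaussian_mean g \<open>a > 0\<close>) (simp only: eq)
  finally show ?thesis by (simp add: scaleR_conv_of_real)
qed

text \<open>The weight times the conjugate kernel is exp (- pi (z - v) . cnj z), the polarized
  Gaussian with \<open>a = pi\<close> and \<open>w = 0\<close>, whose constant (pi / a)^n is
  one.\<close>

lemma fock_reproducing:
  assumes f: "f \<in> fock_space"
  shows "fock_inner f (fock_ker v) = f v"
proof -
  have ent: "entire_cvec f" using f by (simp add: fock_space_iff)
  have eq: "exp (- pi * (norm z)\<^sup>2) *\<^sub>R (f z * cnj (fock_ker v z)) = exp (- of_real pi * cdot (z - v) (z - 0)) * f z" for z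
    by (simp add: exp_cnj cnj_cdot fock_ker_def scaleR_conv_of_real exp_of_real[symmetric] cdot_diff_left
        cdot_self exp_diff exp_minus field_simps)
  have meas: "(\<lambda>z. f z * cnj (fock_ker v z)) \<in> borel_measurable borel"
    using f fock_ker_L2
    by (auto simp: fock_space_iff fock_L2_iff intro!: borel_measurable_times borel_measurable_cnj)
  have "integrable fock_measure (\<lambda>z. f z * cnj (fock_ker v z))"
    by (intro fock_L2_mult_integrable fock_space_L2 f fock_ker_space)
  then have "integrable lborel (\<lambda>z. exp (- of_real pi * cdot (z - v) (z - 0)) * f z)"
    by (simp only: integrable_fock_measure_iff[OF meas] eq)
  from entire_cvec_gaussian_polarized[OF ent pi_gt_zero this] show ?thesis
    by (simp only: fock_inner_def integral_fock_measure[OF meas] eq) simp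
qed

lemma fock_inner_ker_left:
  assumes "f \<in> fock_space"
  shows "fock_inner (fock_ker v) f = cnj (f v)"
  by (subst cnj_fock_inner[symmetric]) (simp add: fock_reproducing[OF assms])

lemma fock_norm_ker: "fock_norm (fock_ker v) = exp (pi / 2 * (norm v)\<^sup>2)"
proof -
  have "complex_of_real ((fock_norm (fock_ker v))\<^sup>2) = of_real ((exp (pi / 2 * (norm v)\<^sup>2))\<^sup>2)"
    unfolding fock_inner_self[symmetric] fock_reproducing[OF fock_ker_space]
    by (simp add: fock_ker_def cdot_self exp_of_real[symmetric] exp_double[symmetric])
  then show ?thesis
    by (simp only: of_real_eq_iff power2_eq_iff_nonneg fock_norm_nonneg exp_ge_zero)
qed

lemma fock_pointwise_bound:
  assumes "f \<in> fock_space"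
  shows "cmod (f v) \<le> fock_norm f * exp (pi / 2 * (norm v)\<^sup>2)"
  using fock_Cauchy_Schwarz[OF fock_space_L2[OF assms] fock_ker_L2, of v]
  by (simp add: fock_reproducing[OF assms] fock_norm_ker)

lemma fock_norm_eq_0:
  assumes "f \<in> fock_space" "fock_norm f = 0"
  shows "f = (\<lambda>z. 0)"
  using fock_pointwise_bound[OF assms(1)] assms(2) by auto

section \<open>The distance of kernels, and uniqueness of the projection\<close>

text \<open>The distance between evaluation at \<open>v\<close> and evaluation at \<open>w\<close>
  as functionals on the Fock space. Measuring oscillation with it, as in
  \<open>fock_lipschitz\<close>, makes the later estimates uniform in \<open>f\<close>.\<close>

definition ker_dist :: "complex ^ 'n \<Rightarrow> complex ^ 'n \<Rightarrow> real" where
  "ker_dist v w = fock_norm (\<lambda>z. fock_ker v z - fock_ker w z)"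

lemma ker_dist_nonneg [simp]: "0 \<le> ker_dist v w"
  by (simp add: ker_dist_def)

lemma ker_dist_self [simp]: "ker_dist v v = 0"
  by (simp add: ker_dist_def fock_norm_def)

text \<open>The reproducing property evaluates all inner products, so that no integral is left and
  continuity in both points becomes elementary.\<close>

lemma ker_dist_sq:
  "(ker_dist v w)\<^sup>2 = exp (pi * (norm v)\<^sup>2) + exp (pi * (norm w)\<^sup>2) - 2 * Re (fock_ker v w)"
proof -
  have "complex_of_real ((ker_dist v w)\<^sup>2) = fock_ker v v + fock_ker w w - (fock_ker v w + cnj (fock_ker v w))"
    unfolding ker_dist_def fock_inner_self[symmetric]
    by (simp add: fock_inner_diff_left fock_inner_diff_right fock_L2_diff fock_ker_L2
        fock_reproducing fock_ker_space cnj_fock_ker)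
  also have "\<dots> = of_real (exp (pi * (norm v)\<^sup>2) + exp (pi * (norm w)\<^sup>2) - 2 * Re (fock_ker v w))"
    by (simp only: complex_add_cnj) (simp add: fock_ker_def cdot_self exp_of_real[symmetric])
  finally show ?thesis
    by (simp only: of_real_eq_iff)
qed

lemma continuous_on_ker_dist [continuous_intros]:
  assumes "continuous_on A f" "continuous_on A g"
  shows "continuous_on A (\<lambda>x. ker_dist (f x) (g x))"
proof -
  have eq: "ker_dist v w = sqrt (exp (pi * (norm v)\<^sup>2) + exp (pi * (norm w)\<^sup>2) - 2 * Re (fock_ker v w))" for v w
    by (simp add: ker_dist_sq[symmetric])
  show ?thesis
    unfolding eq fock_ker_def by (auto intro!: continuous_intros assms)
qed

lemma fock_lipschitz:
  assumes "f \<in> fock_space"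
  shows "cmod (f v - f w) \<le> fock_norm f * ker_dist v w"
proof -
  have "f v - f w = fock_inner f (\<lambda>z. fock_ker v z - fock_ker w z)"
    using assms by (simp add: fock_inner_diff_right fock_ker_L2 fock_space_L2 fock_reproducing)
  then show ?thesis
    unfolding ker_dist_def
    using fock_Cauchy_Schwarz[of f "\<lambda>z. fock_ker v z - fock_ker w z"] assms
    by (simp add: fock_L2_diff fock_ker_L2 fock_space_L2)
qed

text \<open>Two candidates differ by an element of the Fock space that is orthogonal to itself, and
  an element of norm zero vanishes at every point by \<open>fock_pointwise_bound\<close>. So the
  candidate \<open>h\<close> settles existence and value of the description together.\<close>

lemma fock_proj_eqI:
  assumes g: "g \<in> fock_L2" and h: "h \<in> fock_space"
    and orth: "\<And>k. k \<in> fock_space \<Longrightarrow> fock_inner (\<lambda>z. g z - h z) k = 0"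
  shows "fock_proj g = h"
  unfolding fock_proj_def
proof (rule the_equality)
  fix h' assume h': "h' \<in> fock_space \<and> (\<forall>k\<in>fock_space. fock_inner (\<lambda>z. g z - h' z) k = 0)"
  let ?d = "\<lambda>z. h' z - h z"
  have d: "?d \<in> fock_space" using h h' by (simp add: fock_space_diff)
  have "?d = (\<lambda>z. (g z - h z) - (g z - h' z))" by auto
  then have "fock_inner ?d ?d = fock_inner (\<lambda>z. (g z - h z) - (g z - h' z)) ?d"
    by (rule arg_cong)
  also have "\<dots> = fock_inner (\<lambda>z. g z - h z) ?d - fock_inner (\<lambda>z. g z - h' z) ?d"
    using h' by (intro fock_inner_diff_left fock_L2_diff fock_space_L2 g h d) auto
  finally have "fock_norm ?d = 0"
    using orth[OF d] h' d by (simp add: fock_inner_self)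
  from fock_norm_eq_0[OF d this] show "h' = h"
    by (auto simp: fun_eq_iff)
qed (use assms in auto)

subsection \<open>Discretizing the resolution of the identity\<close>

text \<open>Quadrature with nodes \<open>p\<close> and weights \<open>\<mu>\<close> for the integral
  of f(z) K_z over the Gaussian measure.\<close>

definition sample_op :: "nat \<Rightarrow> (nat \<Rightarrow> complex ^ 'n) \<Rightarrow> (nat \<Rightarrow> real) \<Rightarrow>
    (complex ^ 'n \<Rightarrow> complex) \<Rightarrow> complex ^ 'n \<Rightarrow> complex" where
  "sample_op N p \<mu> f = (\<lambda>z. \<Sum>i<N. (of_real (\<mu> i) * f (p i)) * fock_ker (p i) z)"

lemma sample_op_space: "sample_op N p \<mu> f \<in> fock_space"
  unfolding sample_op_def by (intro fock_space_sum fock_space_cmult fock_ker_space) auto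

lemma fock_L2_indicator:
  assumes "f \<in> fock_L2" "A \<in> sets borel"
  shows "(\<lambda>z. indicator A z * f z) \<in> fock_L2"
proof (rule fock_L2_mono[OF assms(1), where C = 1])
  show "(\<lambda>z. indicator A z * f z) \<in> borel_measurable borel"
    using assms by (intro borel_measurable_times borel_measurable_indicator) (auto simp: fock_L2_iff)
qed (auto simp: indicator_def)

text \<open>Each set of a finite subcover loses its predecessors and is cut down to
  \<open>K\<close>. A node \<open>p i\<close> may thereby fall outside its own cell, so closeness is
  expressed by \<open>U (p i)\<close> instead.\<close>

lemma finite_small_partition:
  fixes U :: "'a::t2_space \<Rightarrow> 'a set"
  assumes "compact K" "\<And>x. open (U x)" "\<And>x. x \<in> U x"
  obtains N p A where
    "\<And>i. A i \<in> sets borel" "\<And>i. A i \<subseteq> U (p i)" "disjoint_family A" "(\<Union>i<N::nat. A i) = K"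
proof -
  have "K \<subseteq> (\<Union>x\<in>K. U x)" using assms(3) by blast
  from compactE_image[OF assms(1) assms(2) this]
  obtain D where D: "finite D" "K \<subseteq> (\<Union>x\<in>D. U x)" by metis
  obtain N p where p: "D = p ` {i::nat. i < N}"
    using finite_imp_nat_seg_image_inj_on[OF D(1)] by metis
  define A where "A i = K \<inter> disjointed (\<lambda>i. U (p i)) i" for i
  have "closed K" using assms(1) by (rule compact_imp_closed)
  show ?thesis
  proof
    show "A i \<in> sets borel" for i
      unfolding A_def disjointed_def
      using \<open>closed K\<close> assms(2) by (intro sets.Int sets.Diff sets.finite_UN) auto
    show "A i \<subseteq> U (p i)" for i
      by (auto simp: A_def disjointed_def)
    show "disjoint_family A"
      using disjoint_family_disjointed[of "\<lambda>i. U (p i)"]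
      unfolding A_def disjoint_family_on_def by blast
    have "(\<Union>i<N. disjointed (\<lambda>i. U (p i)) i) = (\<Union>x\<in>D. U x)"
      using finite_UN_disjointed_eq[of "\<lambda>i. U (p i)" N] by (auto simp: p atLeast0LessThan)
    then show "(\<Union>i<N. A i) = K"
      using D(2) by (auto simp: A_def)
  qed
qed

text \<open>The error is tested against itself: it lies in the Fock space, so that every inner product
  below is a combination of point values.\<close>

lemma fock_quadrature:
  fixes R \<eta> :: real
  assumes "\<eta> > 0"
  shows "\<exists>N (p :: nat \<Rightarrow> complex ^ 'n) \<mu>. \<forall>f\<in>fock_space.
    fock_norm (\<lambda>z. sample_op N p \<mu> f z - f z) \<le>
      \<eta> * fock_norm f + fock_norm (\<lambda>z. indicator (- cball 0 R) z * f z)"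
proof -
  interpret prob_space "fock_measure :: (complex ^ 'n) measure"
    by (rule prob_space_fock_measure)
  define E :: "complex ^ 'n \<Rightarrow> real" where "E z = exp (pi / 2 * (norm z)\<^sup>2)" for z
  \<comment> \<open>\<open>E z\<close> is the norm of K_z. Replacing \<open>f z * cnj (g z)\<close>
    by its value at \<open>x\<close> costs at most \<open>ker_dist z x * (E z + E x)\<close> times
    both norms. The condition mentions neither function, so one partition serves every
    \<open>f\<close> and its error \<open>g\<close>.\<close>
  define U where "U x = {z. ker_dist z x * (E z + E x) < \<eta>}" for x
  have "open (U x)" for x
    unfolding U_def E_def by (intro open_Collect_less continuous_intros)
  moreover have "x \<in> U x" for x
    using \<open>\<eta> > 0\<close> by (simp add: U_def)
  ultimately obtain N and p :: "nat \<Rightarrow> complex ^ 'n" and A where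
    A: "\<And>i. A i \<in> sets borel" "\<And>i. A i \<subseteq> U (p i)" "disjoint_family A" and
    cover: "(\<Union>i<N. A i) = cball 0 R"
    using finite_small_partition[OF compact_cball, of U 0 R] by metis
  define B where "B = - cball (0 :: complex ^ 'n) R"
  have B: "B \<in> sets borel" by (simp add: B_def)
  define \<mu> where "\<mu> i = measure fock_measure (A i)" for i
  \<comment> \<open>The cells fill the ball exactly; what the quadrature misses is \<open>B\<close>,
    the source of the tail term.\<close>
  have unity: "(\<Sum>i<N. indicator (A i) z) + indicator B z = (1::real)" for z
  proof -
    have "indicator (\<Union>i<N. A i) z = (\<Sum>i<N. indicator (A i) z :: real)"
      using A(3) by (intro indicator_UN_disjoint) (auto simp: disjoint_family_on_def)
    then show ?thesis by (auto simp: cover B_def indicator_def)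
  qed
  show ?thesis
  proof (intro exI ballI)
    fix f :: "complex ^ 'n \<Rightarrow> complex" assume f: "f \<in> fock_space"
    define g where "g z = sample_op N p \<mu> f z - f z" for z
    have g: "g \<in> fock_space"
      unfolding g_def by (intro fock_space_diff sample_op_space f)
    have fg_int: "integrable fock_measure (\<lambda>z. f z * cnj (g z))"
      by (intro fock_L2_mult_integrable fock_space_L2 f g)
    \<comment> \<open>The error on one cell: sampled value minus true value of the integrand of the
      inner product with \<open>g\<close>.\<close>
    define d where "d i z = indicator (A i) z *\<^sub>R (f (p i) * cnj (g (p i)) - f z * cnj (g z))" for i z
    have d_int: "integrable fock_measure (d i)" for i
      unfolding d_def using fg_int A(1)
      by (intro integrable_mult_indicator Bochner_Integration.integrable_diff) auto
    have d_bound: "cmod (LINT z|fock_measure. d i z) \<le> \<mu> i * (\<eta> * fock_norm f * fock_norm g)" for i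
    proof -
      have "cmod (d i z) \<le> indicator (A i) z * (\<eta> * fock_norm f * fock_norm g)" for z
      proof (cases "z \<in> A i")
        case True
        let ?x = "p i"
        have "f ?x * cnj (g ?x) - f z * cnj (g z) = (f ?x - f z) * cnj (g ?x) + f z * cnj (g ?x - g z)"
          by (simp add: algebra_simps)
        then have "cmod (d i z) \<le> cmod (f ?x - f z) * cmod (g ?x) + cmod (f z) * cmod (g ?x - g z)"
          using True norm_triangle_ineq[of "(f ?x - f z) * cnj (g ?x)" "f z * cnj (g ?x - g z)"]
          by (simp add: d_def norm_mult flip: complex_cnj_diff)
        also have "\<dots> \<le> (fock_norm f * ker_dist z ?x) * (fock_norm g * E ?x) +
            (fock_norm f * E z) * (fock_norm g * ker_dist z ?x)"
          using fock_lipschitz[OF f, of z ?x] fock_lipschitz[OF g, of z ?x]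
            fock_pointwise_bound[OF f, of z] fock_pointwise_bound[OF g, of ?x]
          unfolding E_def by (intro add_mono mult_mono) (simp_all add: norm_minus_commute)
        also have "\<dots> = (ker_dist z ?x * (E z + E ?x)) * (fock_norm f * fock_norm g)"
          by (simp add: algebra_simps)
        also have "\<dots> \<le> \<eta> * (fock_norm f * fock_norm g)"
          using True A(2)[of i] by (intro mult_right_mono) (auto simp: U_def)
        finally show ?thesis using True by simp
      qed (simp add: d_def)
      then have "cmod (LINT z|fock_measure. d i z) \<le>
          (LINT z|fock_measure. indicator (A i) z * (\<eta> * fock_norm f * fock_norm g))"
        by (intro Bochner_Integration.integral_norm_bound_integral d_int integrable_mult_left
            integrable_real_indicator) (use A(1) in \<open>auto simp: emeasure_eq_measure\<close>)
      then show ?thesis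
        using A(1) by (simp add: \<mu>_def)
    qed
    have \<mu>_sum: "(\<Sum>i<N. \<mu> i) \<le> 1"
    proof -
      have "(\<Sum>i<N. \<mu> i) = measure fock_measure (\<Union>i<N. A i)"
        unfolding \<mu>_def using A by (intro finite_measure_finite_Union[symmetric])
          (auto simp: disjoint_family_on_def)
      then show ?thesis by simp
    qed
    have "fock_inner (sample_op N p \<mu> f) g = (\<Sum>i<N. of_real (\<mu> i) * (f (p i) * cnj (g (p i))))"
      unfolding sample_op_def
      by (simp add: fock_inner_sum_left fock_L2_cmult fock_ker_L2 fock_space_L2[OF g]
          fock_inner_cmult_left fock_inner_ker_left[OF g] mult.assoc)
    also have "\<dots> = (\<Sum>i<N. LINT z|fock_measure. indicator (A i) z *\<^sub>R (f (p i) * cnj (g (p i))))"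
      using A(1) by (simp add: \<mu>_def scaleR_conv_of_real)
    also have "\<dots> = (\<Sum>i<N. LINT z|fock_measure. d i z + indicator (A i) z *\<^sub>R (f z * cnj (g z)))"
      by (simp add: d_def scaleR_diff_right)
    also have "\<dots> = (\<Sum>i<N. (LINT z|fock_measure. d i z) + (LINT z|fock_measure. indicator (A i) z *\<^sub>R (f z * cnj (g z))))"
      using A(1) by (intro sum.cong refl Bochner_Integration.integral_add d_int integrable_mult_indicator fg_int) auto
    also have "\<dots> = (\<Sum>i<N. LINT z|fock_measure. d i z) + (LINT z|fock_measure. (\<Sum>i<N. indicator (A i) z *\<^sub>R (f z * cnj (g z))))"
      using A(1) by (subst Bochner_Integration.integral_sum)
        (auto intro!: integrable_mult_indicator fg_int simp: sum.distrib)
    also have "(LINT z|fock_measure. (\<Sum>i<N. indicator (A i) z *\<^sub>R (f z * cnj (g z)))) =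
        (LINT z|fock_measure. (f z - indicator B z * f z) * cnj (g z))"
    proof (rule Bochner_Integration.integral_cong[OF refl])
      fix z
      have "(\<Sum>i<N. indicator (A i) z) = (1::real) - indicator B z"
        using unity[of z] by simp
      then show "(\<Sum>i<N. indicator (A i) z *\<^sub>R (f z * cnj (g z))) = (f z - indicator B z * f z) * cnj (g z)"
        unfolding scaleR_sum_left[symmetric] by (simp add: indicator_def)
    qed
    also have "\<dots> = fock_inner f g - fock_inner (\<lambda>z. indicator B z * f z) g"
      unfolding fock_inner_def[symmetric]
      by (intro fock_inner_diff_left fock_L2_indicator fock_space_L2 f g B)
    finally have "fock_inner g g = (\<Sum>i<N. LINT z|fock_measure. d i z) - fock_inner (\<lambda>z. indicator B z * f z) g"
      using fock_inner_diff_left[OF fock_space_L2 fock_space_L2 fock_space_L2, OF sample_op_space f g]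
      by (simp add: g_def[abs_def])
    then have "(fock_norm g)\<^sup>2 = cmod ((\<Sum>i<N. LINT z|fock_measure. d i z) - fock_inner (\<lambda>z. indicator B z * f z) g)"
      by (metis fock_inner_self norm_of_real abs_of_nonneg zero_le_power2)
    also have "\<dots> \<le> (\<Sum>i<N. \<mu> i * (\<eta> * fock_norm f * fock_norm g)) + fock_norm (\<lambda>z. indicator B z * f z) * fock_norm g"
      by (intro order_trans[OF norm_triangle_ineq4] add_mono order_trans[OF norm_sum] sum_mono d_bound
          fock_Cauchy_Schwarz fock_L2_indicator fock_space_L2 f g B)
    also have "\<dots> \<le> (\<eta> * fock_norm f + fock_norm (\<lambda>z. indicator B z * f z)) * fock_norm g"
    proof -
      have "(\<Sum>i<N. \<mu> i) * (\<eta> * fock_norm f * fock_norm g) \<le> 1 * (\<eta> * fock_norm f * fock_norm g)"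
        using \<open>\<eta> > 0\<close> by (intro mult_right_mono \<mu>_sum) simp
      then show ?thesis
        unfolding sum_distrib_right[symmetric] distrib_right by simp
    qed
    finally have "fock_norm g * fock_norm g \<le> (\<eta> * fock_norm f + fock_norm (\<lambda>z. indicator B z * f z)) * fock_norm g"
      by (simp add: power2_eq_square)
    \<comment> \<open>One factor \<open>fock_norm g\<close> is cancelled; if it is zero, the bound
      is trivial.\<close>
    then have "fock_norm g \<le> \<eta> * fock_norm f + fock_norm (\<lambda>z. indicator B z * f z)"
      using \<open>\<eta> > 0\<close> mult_right_le_imp_le[of "fock_norm g" "fock_norm g"] fock_norm_nonneg[of g]
      by (cases "fock_norm g = 0") (simp, fastforce)
    then show "fock_norm (\<lambda>z. sample_op N p \<mu> f z - f z) \<le>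
      \<eta> * fock_norm f + fock_norm (\<lambda>z. indicator (- cball 0 R) z * f z)"
      by (simp add: g_def[abs_def] B_def)
  qed
qed

lemma fock_norm_tail:
  fixes f :: "complex ^ 'n \<Rightarrow> complex"
  assumes f: "f \<in> fock_L2"
  shows "(\<lambda>m. fock_norm (\<lambda>z. indicator (- cball 0 (real m)) z * f z)) \<longlonglongrightarrow> 0"
proof -
  have "(\<lambda>m. LINT z|fock_measure. (cmod (indicator (- cball 0 (real m)) z * f z))\<^sup>2) \<longlonglongrightarrow>
      (LINT z|(fock_measure :: (complex ^ 'n) measure). 0)"
  proof (rule integral_dominated_convergence[where w = "\<lambda>z. (cmod (f z))\<^sup>2"])
    show "AE z in fock_measure. (\<lambda>m. (cmod (indicator (- cball 0 (real m)) z * f z))\<^sup>2) \<longlonglongrightarrow> 0"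
    proof (rule AE_I2)
      fix z :: "complex ^ 'n"
      obtain M where M: "norm z \<le> real M" using real_arch_simple by blast
      have "(cmod (indicator (- cball 0 (real m)) z * f z))\<^sup>2 = 0" if "m \<ge> M" for m
        using M that by (auto simp: indicator_def)
      then show "(\<lambda>m. (cmod (indicator (- cball 0 (real m)) z * f z))\<^sup>2) \<longlonglongrightarrow> 0"
        by (intro tendsto_eventually) (auto simp: eventually_sequentially)
    qed
    show "(\<lambda>z. (cmod (indicator (- cball 0 (real m)) z * f z))\<^sup>2) \<in> borel_measurable fock_measure" for m
      using fock_L2_measurable[OF fock_L2_indicator[OF f, of "- cball 0 (real m)"]]
      by (intro borel_measurable_power borel_measurable_norm) simp_all
  qed (use f in \<open>auto simp: fock_L2_iff indicator_def\<close>)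
  from tendsto_real_sqrt[OF this] show ?thesis
    by (simp add: fock_norm_def)
qed

lemma fock_quadrature_sequence:
  obtains N :: "nat \<Rightarrow> nat" and p :: "nat \<Rightarrow> nat \<Rightarrow> complex ^ 'n" and \<mu> where
    "\<And>m f. f \<in> fock_space \<Longrightarrow> fock_norm (sample_op (N m) (p m) (\<mu> m) f) \<le> 3 * fock_norm f"
    "\<And>f. f \<in> fock_space \<Longrightarrow> (\<lambda>m. fock_norm (\<lambda>z. sample_op (N m) (p m) (\<mu> m) f z - f z)) \<longlonglongrightarrow> 0"
proof -
  \<comment> \<open>Stage \<open>m\<close> takes radius \<open>m\<close> and tolerance 1 / (m + 1),
    which is positive already for \<open>m = 0\<close>.\<close>
  define P where "P m N p \<mu> \<longleftrightarrow> (\<forall>f\<in>fock_space. fock_norm (\<lambda>z. sample_op N p \<mu> f z - f z) \<le>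
      inverse (real (Suc m)) * fock_norm f + fock_norm (\<lambda>z. indicator (- cball 0 (real m)) z * f z))"
    for m N \<mu> and p :: "nat \<Rightarrow> complex ^ 'n"
  have "\<exists>N p \<mu>. P m N p \<mu>" for m
    unfolding P_def by (intro fock_quadrature) simp
  then obtain N p \<mu> where "P m (N m) (p m) (\<mu> m)" for m
    by metis
  then have *: "\<And>m f. f \<in> fock_space \<Longrightarrow>
    fock_norm (\<lambda>z. sample_op (N m) (p m) (\<mu> m) f z - f z) \<le>
      inverse (real (Suc m)) * fock_norm f + fock_norm (\<lambda>z. indicator (- cball 0 (real m)) z * f z)"
    unfolding P_def by blast
  show ?thesis
  proof
    fix f :: "complex ^ 'n \<Rightarrow> complex" assume f: "f \<in> fock_space"
    let ?b = "\<lambda>m. inverse (real (Suc m)) * fock_norm f + fock_norm (\<lambda>z. indicator (- cball 0 (real m)) z * f z)"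
    have lim: "?b \<longlonglongrightarrow> 0 * fock_norm f + 0"
      by (intro tendsto_intros LIMSEQ_inverse_real_of_nat fock_norm_tail fock_space_L2 f)
    have "norm (fock_norm (\<lambda>z. sample_op (N m) (p m) (\<mu> m) f z - f z)) \<le> ?b m" for m
      using *[OF f, of m] by (simp only: real_norm_def abs_of_nonneg fock_norm_nonneg)
    then have le: "\<forall>\<^sub>F m in sequentially. norm (fock_norm (\<lambda>z. sample_op (N m) (p m) (\<mu> m) f z - f z)) \<le> ?b m"
      by (intro always_eventually allI)
    have "?b \<longlonglongrightarrow> 0" using lim by (simp only: mult_zero_left add_0_left)
    from Lim_null_comparison[OF le this]
    show "(\<lambda>m. fock_norm (\<lambda>z. sample_op (N m) (p m) (\<mu> m) f z - f z)) \<longlonglongrightarrow> 0" .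
    fix m
    \<comment> \<open>The constant 3 counts the tolerance, which is at most one, the tail, which is
      at most the whole norm, and \<open>f\<close> itself.\<close>
    have "fock_norm (\<lambda>z. indicator (- cball 0 (real m)) z * f z) \<le> fock_norm f"
      using f by (intro fock_norm_mono fock_L2_indicator) (auto simp: fock_space_L2 indicator_def)
    moreover have "inverse (real (Suc m)) * fock_norm f \<le> 1 * fock_norm f"
      by (intro mult_right_mono) (auto simp: inverse_le_1_iff)
    moreover have "fock_norm (sample_op (N m) (p m) (\<mu> m) f) \<le>
        fock_norm (\<lambda>z. sample_op (N m) (p m) (\<mu> m) f z - f z) + fock_norm f"
      using fock_norm_triangle[of "\<lambda>z. sample_op (N m) (p m) (\<mu> m) f z - f z" f] f
      by (simp add: fock_L2_diff fock_space_L2 sample_op_space)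
    ultimately show "fock_norm (sample_op (N m) (p m) (\<mu> m) f) \<le> 3 * fock_norm f"
      using *[OF f, of m] by linarith
  qed
qed

text \<open>The kernels are total: the quadrature of \<open>k\<close> is a finite combination of
  kernels, hence orthogonal to \<open>\<phi>\<close>, and it converges to \<open>k\<close> in
  norm.\<close>

lemma fock_orthogonalI:
  fixes k :: "complex ^ 'n \<Rightarrow> complex"
  assumes \<phi>: "\<phi> \<in> fock_L2" and ker: "\<And>q. fock_inner \<phi> (fock_ker q) = 0" and k: "k \<in> fock_space"
  shows "fock_inner \<phi> k = 0"
proof -
  obtain N and p :: "nat \<Rightarrow> nat \<Rightarrow> complex ^ 'n" and \<mu> where lim: "\<And>f. f \<in> fock_space \<Longrightarrow>
      (\<lambda>m::nat. fock_norm (\<lambda>z. sample_op (N m) (p m) (\<mu> m) f z - f z)) \<longlonglongrightarrow> 0"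
    by (rule fock_quadrature_sequence) blast
  have "cmod (fock_inner \<phi> k) \<le> fock_norm \<phi> * fock_norm (\<lambda>z. sample_op (N m) (p m) (\<mu> m) k z - k z)" for m
  proof -
    let ?Q = "sample_op (N m) (p m) (\<mu> m) k"
    have "fock_inner \<phi> ?Q = 0"
      unfolding sample_op_def using \<phi>
      by (simp add: fock_inner_sum_right fock_L2_cmult fock_ker_L2 fock_inner_cmult_right ker)
    then have "fock_inner \<phi> (\<lambda>z. ?Q z - k z) = - fock_inner \<phi> k"
      using \<phi> k by (simp add: fock_inner_diff_right fock_space_L2 sample_op_space)
    then show ?thesis
      using fock_Cauchy_Schwarz[OF \<phi>, of "\<lambda>z. ?Q z - k z"] k
      by (simp add: fock_L2_diff fock_space_L2 sample_op_space)
  qed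
  moreover have "(\<lambda>m. fock_norm \<phi> * fock_norm (\<lambda>z. sample_op (N m) (p m) (\<mu> m) k z - k z)) \<longlonglongrightarrow> fock_norm \<phi> * 0"
    by (intro tendsto_intros lim k)
  ultimately have "cmod (fock_inner \<phi> k) \<le> fock_norm \<phi> * 0"
    by (intro LIMSEQ_le_const) auto
  then show ?thesis by simp
qed

text \<open>By the reproducing property \<open>g\<close> and \<open>h\<close> pair equally with
  every kernel, and kernels are total. This reduces a projection to a family of scalar
  integrals.\<close>

lemma fock_proj_eq_kerI:
  fixes g :: "complex ^ 'n \<Rightarrow> complex"
  assumes g: "g \<in> fock_L2" and h: "h \<in> fock_space" and ker: "\<And>q. fock_inner g (fock_ker q) = h q"
  shows "fock_proj g = h"
proof (rule fock_proj_eqI[OF g h])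
  fix k :: "complex ^ 'n \<Rightarrow> complex" assume k: "k \<in> fock_space"
  have hL2: "h \<in> fock_L2" using h by (rule fock_space_L2)
  show "fock_inner (\<lambda>z. g z - h z) k = 0"
  proof (rule fock_orthogonalI[OF fock_L2_diff[OF g hL2] _ k])
    show "fock_inner (\<lambda>z. g z - h z) (fock_ker q) = 0" for q
      unfolding fock_inner_diff_left[OF g hL2 fock_ker_L2] by (simp add: fock_reproducing h ker)
  qed
qed

subsection \<open>Toeplitz operators close to rank one operators\<close>

lemma vanishing_at_infinity_uniformly_continuous:
  fixes f :: "'a::{heine_borel, real_normed_vector} \<Rightarrow> 'b::real_normed_vector"
  assumes cont: "continuous_on UNIV f" and lim: "(f \<longlongrightarrow> 0) at_infinity"
  shows "uniformly_continuous_on UNIV f" "bounded (range f)"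
proof -
  have far: "\<exists>R>0. \<forall>x. R \<le> norm x \<longrightarrow> norm (f x) < e" if "e > 0" for e
    using tendstoD[OF lim that] by (auto simp: eventually_at_infinity_pos)
  show "uniformly_continuous_on UNIV f"
    unfolding uniformly_continuous_on_def
  proof (intro allI impI)
    fix e :: real assume "e > 0"
    with far[of "e / 2"] obtain R where R: "\<And>x. R \<le> norm x \<Longrightarrow> norm (f x) < e / 2"
      by auto
    \<comment> \<open>With the margin 1, two points closer than 1 either both lie in this ball or
      both have norm at least \<open>R\<close>.\<close>
    have "uniformly_continuous_on (cball 0 (R + 1)) f"
      using cont by (intro compact_uniformly_continuous) (auto intro: continuous_on_subset)
    with \<open>e > 0\<close> obtain d where d: "d > 0"
      "\<And>x y. x \<in> cball 0 (R + 1) \<Longrightarrow> y \<in> cball 0 (R + 1) \<Longrightarrow> dist y x < d \<Longrightarrow> dist (f y) (f x) < e"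
      unfolding uniformly_continuous_on_def by metis
    have "dist (f y) (f x) < e" if "dist y x < min d 1" for x y
    proof (cases "norm x \<le> R + 1 \<and> norm y \<le> R + 1")
      case True
      then show ?thesis using that d(2)[of x y] by auto
    next
      case False
      then have "R \<le> norm x" "R \<le> norm y"
        using that norm_triangle_ineq2[of x y] norm_triangle_ineq2[of y x]
        by (auto simp: dist_norm norm_minus_commute)
      then show ?thesis
        using R[of x] R[of y] norm_triangle_ineq4[of "f y" "f x"] by (simp add: dist_norm)
    qed
    with d(1) show "\<exists>d>0. \<forall>x\<in>UNIV. \<forall>x'\<in>UNIV. dist x' x < d \<longrightarrow> dist (f x') (f x) < e"
      by (intro exI[of _ "min d 1"]) auto
  qed
  obtain R where R: "\<And>x. R \<le> norm x \<Longrightarrow> norm (f x) < 1"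
    using far[of 1] by auto
  have "bounded (f ` cball 0 R)"
    using cont by (intro compact_imp_bounded compact_continuous_image) (auto intro: continuous_on_subset)
  then obtain B where "\<forall>x\<in>cball 0 R. norm (f x) \<le> B"
    unfolding bounded_iff by auto
  then have B: "norm x \<le> R \<Longrightarrow> norm (f x) \<le> B" for x
    by simp
  have "norm (f x) \<le> max B 1" for x
    using R[of x] B[of x] by (cases "norm x \<le> R") auto
  then show "bounded (range f)"
    unfolding bounded_iff by blast
qed

text \<open>For \<open>v = w\<close> these Gaussians concentrate at \<open>v\<close> as \<open>t\<close> tends to 0, which yields
  \<open>f v * cnj (g v)\<close>; letting the two centers differ polarizes this to \<open>f v * cnj (g w)\<close>. The factor
  \<open>exp (pi * (norm z)\<^sup>2)\<close> cancels the weight of the measure.\<close>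

definition gauss_symbol :: "complex ^ 'n \<Rightarrow> complex ^ 'n \<Rightarrow> real \<Rightarrow> complex ^ 'n \<Rightarrow> complex" where
  "gauss_symbol v w t z = of_real ((1 / t) ^ CARD('n)) *
     exp (of_real (pi * (norm z)\<^sup>2) - of_real (pi / t) * cdot (z - v) (z - w))"

lemma continuous_gauss_symbol: "continuous_on A (gauss_symbol v w t)"
  unfolding gauss_symbol_def[abs_def] by (intro continuous_intros)

lemma gauss_symbol_vanishes:
  fixes v w :: "complex ^ 'n"
  assumes t: "0 < t" "t \<le> 1 / 2"
  shows "(gauss_symbol v w t \<longlongrightarrow> 0) at_infinity"
proof (rule Lim_null_comparison)
  \<comment> \<open>The net decay rate: the Gaussian at rate \<open>pi / t\<close> has to beat the
    growth at rate \<open>pi\<close> that cancels the weight.\<close>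
  define a where "a = pi / t - pi"
  define b where "b = pi / t * norm (v + w)"
  define C where "C = (1 / t) ^ CARD('n) * exp (- (pi / t) * (v \<bullet> w))"
  have "pi * t \<le> pi * (1 / 2)" using t by (intro mult_left_mono) auto
  then have "pi * t < pi" using pi_gt_zero by linarith
  then have "a > 0" using t by (simp add: a_def field_simps)
  have "norm (gauss_symbol v w t z) \<le> C * exp (b * norm z - a * (norm z)\<^sup>2)" for z
  proof -
    have "(z - v) \<bullet> (z - w) = (norm z)\<^sup>2 - z \<bullet> (v + w) + v \<bullet> w"
      by (simp add: power2_norm_eq_inner inner_diff inner_add inner_commute algebra_simps)
    then have "pi * (norm z)\<^sup>2 - pi / t * ((z - v) \<bullet> (z - w)) =
        pi / t * (z \<bullet> (v + w)) - a * (norm z)\<^sup>2 - pi / t * (v \<bullet> w)"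
      by (simp only: a_def) (simp add: algebra_simps)
    moreover have "pi / t * (z \<bullet> (v + w)) \<le> pi / t * (norm z * norm (v + w))"
      using t by (intro mult_left_mono norm_cauchy_schwarz) auto
    ultimately have "pi * (norm z)\<^sup>2 - pi / t * ((z - v) \<bullet> (z - w)) \<le>
        - (pi / t) * (v \<bullet> w) + (b * norm z - a * (norm z)\<^sup>2)"
      by (simp add: b_def mult_ac)
    then have "exp (pi * (norm z)\<^sup>2 - pi / t * ((z - v) \<bullet> (z - w))) \<le>
        exp (- (pi / t) * (v \<bullet> w)) * exp (b * norm z - a * (norm z)\<^sup>2)"
      by (simp only: exp_add[symmetric] exp_le_cancel_iff)
    then have "(1 / t) ^ CARD('n) * exp (pi * (norm z)\<^sup>2 - pi / t * ((z - v) \<bullet> (z - w))) \<le>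
        (1 / t) ^ CARD('n) * (exp (- (pi / t) * (v \<bullet> w)) * exp (b * norm z - a * (norm z)\<^sup>2))"
      using t by (intro mult_left_mono) auto
    moreover have "norm (gauss_symbol v w t z) =
        (1 / t) ^ CARD('n) * exp (pi * (norm z)\<^sup>2 - pi / t * ((z - v) \<bullet> (z - w)))"
      using t by (simp add: gauss_symbol_def norm_mult norm_power norm_divide Re_cdot)
    ultimately show ?thesis
      by (simp only: C_def mult.assoc)
  qed
  then show "\<forall>\<^sub>F z in at_infinity. norm (gauss_symbol v w t z) \<le> C * exp (b * norm z - a * (norm z)\<^sup>2)"
    by simp
  have "((\<lambda>r. C * exp (b * r - a * r\<^sup>2)) \<longlongrightarrow> 0) at_top"
    using \<open>a > 0\<close> by real_asymp
  then show "((\<lambda>z::complex^'n. C * exp (b * norm z - a * (norm z)\<^sup>2)) \<longlongrightarrow> 0) at_infinity"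
    by (rule filterlim_compose[OF _ filterlim_norm_at_top])
qed

lemma fock_L2_bounded_mult:
  assumes "f \<in> fock_L2" "a \<in> borel_measurable borel" "bounded (range a)"
  shows "(\<lambda>z. a z * f z) \<in> fock_L2"
proof -
  obtain B where "\<And>z. cmod (a z) \<le> B"
    using assms(3) unfolding bounded_iff by auto
  then have "cmod (a z * f z) \<le> B * cmod (f z)" for z
    by (simp add: norm_mult mult_right_mono)
  then show ?thesis
    using assms by (intro fock_L2_mono[OF assms(1), of _ B]) (auto simp: fock_L2_iff)
qed

lemma gauss_symbol_mult_L2:
  assumes "f \<in> fock_L2" "0 < t" "t \<le> 1 / 2"
  shows "(\<lambda>z. gauss_symbol v w t z * f z) \<in> fock_L2"
  using assms
  by (intro fock_L2_bounded_mult vanishing_at_infinity_uniformly_continuous gauss_symbol_vanishes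
      continuous_gauss_symbol borel_measurable_continuous_onI)

text \<open>The conjugate of K_q contributes pi \<open>cdot q z\<close> to the exponent. Moving the
  centre from \<open>v\<close> to \<open>v + t q\<close> absorbs this, up to the constant factor
  K_w(q). The remaining Gaussian integral evaluates \<open>f\<close> at the new centre, and its
  value t^n cancels the normalization of the symbol.\<close>

lemma gauss_symbol_inner_ker:
  fixes f :: "complex ^ 'n \<Rightarrow> complex"
  assumes f: "f \<in> fock_space" and t: "0 < t" "t \<le> 1 / 2"
  shows "fock_inner (\<lambda>z. gauss_symbol v w t z * f z) (fock_ker q) = fock_ker w q * f (v + t *\<^sub>R q)"
proof -
  let ?g = "\<lambda>z. gauss_symbol v w t z * f z * cnj (fock_ker q z)"
  let ?c = "of_real ((1 / t) ^ CARD('n)) * fock_ker w q"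
  let ?h = "\<lambda>z. exp (- of_real (pi / t) * cdot (z - (v + t *\<^sub>R q)) (z - w)) * f z"
  have eq: "exp (- pi * (norm z)\<^sup>2) *\<^sub>R ?g z = ?c * ?h z" for z
  proof -
    have e: "cdot (z - (v + t *\<^sub>R q)) (z - w) = cdot (z - v) (z - w) - of_real t * (cdot q z - cdot q w)"
      by (simp add: cdot_diff_left cdot_add_left cdot_diff_right cdot_scaleR_left algebra_simps)
    have "- of_real (pi / t) * cdot (z - (v + t *\<^sub>R q)) (z - w) + of_real pi * cdot q w =
        of_real (- pi * (norm z)\<^sup>2) + (of_real (pi * (norm z)\<^sup>2) - of_real (pi / t) * cdot (z - v) (z - w)) +
        of_real pi * cdot q z"
      unfolding e using t by (simp add: field_simps)
    from arg_cong[OF this, of exp]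
    have e': "exp (- of_real (pi / t) * cdot (z - (v + t *\<^sub>R q)) (z - w)) * fock_ker w q =
        of_real (exp (- pi * (norm z)\<^sup>2)) *
        exp (of_real (pi * (norm z)\<^sup>2) - of_real (pi / t) * cdot (z - v) (z - w)) * fock_ker z q"
      by (simp only: exp_add fock_ker_def exp_of_real)
    have "exp (- pi * (norm z)\<^sup>2) *\<^sub>R ?g z = of_real ((1 / t) ^ CARD('n)) * f z *
        (of_real (exp (- pi * (norm z)\<^sup>2)) *
        exp (of_real (pi * (norm z)\<^sup>2) - of_real (pi / t) * cdot (z - v) (z - w)) * fock_ker z q)"
      by (simp only: gauss_symbol_def cnj_fock_ker scaleR_conv_of_real[where 'a = complex] mult_ac)
    also have "\<dots> = ?c * ?h z"
      unfolding e'[symmetric] by (simp only: mult_ac)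
    finally show ?thesis .
  qed
  have L2: "(\<lambda>z. gauss_symbol v w t z * f z) \<in> fock_L2"
    using f t by (intro gauss_symbol_mult_L2 fock_space_L2)
  then have int: "integrable fock_measure ?g"
    by (intro fock_L2_mult_integrable fock_ker_L2)
  have meas: "?g \<in> borel_measurable borel"
    using borel_measurable_integrable[OF int] by simp
  \<comment> \<open>The constant has to be divided out to obtain integrability of \<open>?h\<close>
    itself.\<close>
  have c: "?c \<noteq> 0" using t by (simp add: fock_ker_def)
  have "integrable lborel (\<lambda>z. ?c * ?h z)"
    using int unfolding integrable_fock_measure_iff[OF meas] eq .
  then have "integrable lborel (\<lambda>z. inverse ?c * (?c * ?h z))"
    by (rule integrable_mult_right)
  moreover have "inverse ?c * (?c * x) = x" for x
    using c by (metis mult.assoc left_inverse mult_1_left)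
  ultimately have h_int: "integrable lborel ?h"
    by (simp only:)
  have ent: "entire_cvec f" using f by (simp add: fock_space_iff)
  have "fock_inner (\<lambda>z. gauss_symbol v w t z * f z) (fock_ker q) = (LINT z|lborel. ?c * ?h z)"
    unfolding fock_inner_def integral_fock_measure[OF meas] eq ..
  also have "\<dots> = ?c * (LINT z|lborel. ?h z)"
    by (rule integral_mult_right_zero)
  also have "(LINT z|lborel. ?h z) = of_real ((pi / (pi / t)) ^ CARD('n)) * f (v + t *\<^sub>R q)"
    using t by (intro entire_cvec_gaussian_polarized[OF ent _ h_int]) simp
  finally show ?thesis
    using t by (simp add: power_one_over field_simps)
qed

text \<open>This is what \<open>t \<le> 1 / 2\<close> is for: the critical growth rate pi / 2 of a
  Fock space function becomes pi / 4 in \<open>q\<close>, below the threshold of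
  \<open>fock_L2_bound\<close> and uniformly in \<open>t\<close>.\<close>

lemma norm_sq_affine_le:
  fixes v q :: "'a::real_inner"
  assumes "0 \<le> t" "t \<le> 1 / 2"
  shows "(norm (v + t *\<^sub>R q))\<^sup>2 \<le> 2 * (norm v)\<^sup>2 + (norm q)\<^sup>2 / 2"
proof -
  have "(norm (v + t *\<^sub>R q))\<^sup>2 \<le> (norm v + norm q / 2)\<^sup>2"
  proof (intro power_mono)
    have "norm (v + t *\<^sub>R q) \<le> norm v + t * norm q"
      using norm_triangle_ineq[of v "t *\<^sub>R q"] assms by simp
    moreover have "t * norm q \<le> 1 / 2 * norm q"
      using assms by (intro mult_right_mono) auto
    ultimately show "norm (v + t *\<^sub>R q) \<le> norm v + norm q / 2" by simp
  qed simp
  moreover have "0 \<le> (norm v - norm q / 2)\<^sup>2" by simp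
  ultimately show ?thesis by (simp add: power2_sum power2_diff power_divide)
qed

lemma fock_ker_mult_shift_space:
  assumes f: "f \<in> fock_space" and t: "0 \<le> t" "t \<le> 1 / 2"
  shows "(\<lambda>q. fock_ker w q * f (v + t *\<^sub>R q)) \<in> fock_space"
  unfolding fock_space_iff
proof
  have ent: "entire_cvec f" "entire_cvec (fock_ker w)"
    using f fock_ker_space[of w] by (simp_all add: fock_space_iff)
  then show ent': "entire_cvec (\<lambda>q. fock_ker w q * f (v + t *\<^sub>R q))"
    by (intro entire_cvec_mult entire_cvec_affine)
  show "(\<lambda>q. fock_ker w q * f (v + t *\<^sub>R q)) \<in> fock_L2"
  proof (rule fock_L2_bound)
    fix q
    have "cmod (f (v + t *\<^sub>R q)) \<le> fock_norm f * exp (pi / 2 * (2 * (norm v)\<^sup>2 + (norm q)\<^sup>2 / 2))"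
      by (rule order_trans[OF fock_pointwise_bound[OF f]])
        (intro mult_left_mono fock_norm_nonneg, simp add: norm_sq_affine_le[OF t])
    then have "cmod (fock_ker w q * f (v + t *\<^sub>R q)) \<le>
        exp (pi * norm w * norm q) * (fock_norm f * exp (pi / 2 * (2 * (norm v)\<^sup>2 + (norm q)\<^sup>2 / 2)))"
      unfolding norm_mult by (intro mult_mono cmod_fock_ker_le) auto
    also have "\<dots> = (fock_norm f * exp (pi * (norm v)\<^sup>2)) * exp (pi * norm w * norm q + pi / 4 * (norm q)\<^sup>2)"
      by (simp add: exp_add[symmetric] algebra_simps mult_exp_exp)
    finally show "cmod (fock_ker w q * f (v + t *\<^sub>R q)) \<le>
        (fock_norm f * exp (pi * (norm v)\<^sup>2)) * exp (pi * norm w * norm q + pi / 4 * (norm q)\<^sup>2)" .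
  qed (auto intro: entire_cvec_measurable ent')
qed

text \<open>For fixed \<open>q\<close>, the map from \<open>f\<close> to K_w(q) (f (v + t q) - f v)
  is a functional whose norm is the modulus of this function at \<open>q\<close>. Its
  \<open>fock_norm\<close> is thus the Hilbert-Schmidt norm of the difference between the Toeplitz
  operator and its rank one limit.\<close>

definition shift_error :: "complex ^ 'n \<Rightarrow> complex ^ 'n \<Rightarrow> real \<Rightarrow> complex ^ 'n \<Rightarrow> complex" where
  "shift_error v w t q = fock_ker w q * of_real (ker_dist (v + t *\<^sub>R q) v)"

lemma shift_error_measurable: "shift_error v w t \<in> borel_measurable borel"
  unfolding shift_error_def[abs_def] fock_ker_def
  by (intro borel_measurable_continuous_onI continuous_intros)

text \<open>The right side is free of \<open>t\<close>, so it can dominate the whole family as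
  \<open>t\<close> tends to 0.\<close>

lemma shift_error_le:
  assumes "0 \<le> t" "t \<le> 1 / 2"
  shows "cmod (shift_error v w t q) \<le>
    (2 * exp (3 / 2 * pi * (norm v)\<^sup>2)) * exp (pi * norm w * norm q + pi / 4 * (norm q)\<^sup>2)"
proof -
  have "ker_dist (v + t *\<^sub>R q) v \<le> fock_norm (fock_ker (v + t *\<^sub>R q)) + fock_norm (fock_ker v)"
    using fock_norm_triangle[OF fock_ker_L2 fock_L2_cmult[OF fock_ker_L2], of _ "-1"]
    by (simp add: ker_dist_def fock_norm_cmult fock_norm_def)
  \<comment> \<open>A common exponent for both kernel norms, so that their sum is twice one
    exponential.\<close>
  also have "\<dots> \<le> exp (pi / 2 * (3 * (norm v)\<^sup>2 + (norm q)\<^sup>2 / 2)) + exp (pi / 2 * (3 * (norm v)\<^sup>2 + (norm q)\<^sup>2 / 2))"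
  proof -
    have "(norm (v + t *\<^sub>R q))\<^sup>2 \<le> 3 * (norm v)\<^sup>2 + (norm q)\<^sup>2 / 2"
      using norm_sq_affine_le[OF assms, of v q] zero_le_power2[of "norm v"] by linarith
    moreover have "(norm v)\<^sup>2 \<le> 3 * (norm v)\<^sup>2 + (norm q)\<^sup>2 / 2"
      using zero_le_power2[of "norm v"] zero_le_power2[of "norm q"] by linarith
    ultimately show ?thesis
      unfolding fock_norm_ker by (intro add_mono) simp_all
  qed
  finally have "cmod (shift_error v w t q) \<le>
      exp (pi * norm w * norm q) * (2 * exp (pi / 2 * (3 * (norm v)\<^sup>2 + (norm q)\<^sup>2 / 2)))"
    unfolding shift_error_def norm_mult by (intro mult_mono cmod_fock_ker_le) auto
  also have "\<dots> = (2 * exp (3 / 2 * pi * (norm v)\<^sup>2)) * exp (pi * norm w * norm q + pi / 4 * (norm q)\<^sup>2)"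
    by (simp add: exp_add[symmetric] algebra_simps mult_exp_exp)
  finally show ?thesis .
qed

lemma shift_error_L2:
  assumes "0 \<le> t" "t \<le> 1 / 2"
  shows "shift_error v w t \<in> fock_L2"
  by (rule fock_L2_bound[OF shift_error_measurable _ shift_error_le[OF assms]]) simp

lemma shift_error_tendsto:
  fixes v w :: "complex ^ 'n"
  assumes t: "\<And>k. 0 \<le> t k" "\<And>k. t k \<le> 1 / 2" "t \<longlonglongrightarrow> 0"
  shows "(\<lambda>k. fock_norm (shift_error v w (t k))) \<longlonglongrightarrow> 0"
proof -
  define b :: "complex ^ 'n \<Rightarrow> real" where
    "b q = (2 * exp (3 / 2 * pi * (norm v)\<^sup>2)) * exp (pi * norm w * norm q + pi / 4 * (norm q)\<^sup>2)" for q
  have "(\<lambda>q. of_real (b q)) \<in> fock_L2"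
    unfolding b_def by (rule fock_L2_bound[where a = "pi / 4"])
      (auto simp: norm_mult intro!: borel_measurable_continuous_onI continuous_intros)
  then have b: "integrable fock_measure (\<lambda>q. (b q)\<^sup>2)"
    by (simp add: fock_L2_iff)
  have "(\<lambda>k. LINT q|fock_measure. (cmod (shift_error v w (t k) q))\<^sup>2) \<longlonglongrightarrow>
      (LINT q|(fock_measure :: (complex ^ 'n) measure). 0)"
  proof (rule integral_dominated_convergence[OF _ _ b])
    show "AE q in fock_measure. (\<lambda>k. (cmod (shift_error v w (t k) q))\<^sup>2) \<longlonglongrightarrow> 0"
    proof (rule AE_I2)
      fix q
      have "continuous_on UNIV (\<lambda>s. ker_dist (v + s *\<^sub>R q) v)"
        by (intro continuous_intros)
      then have "isCont (\<lambda>s. ker_dist (v + s *\<^sub>R q) v) 0"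
        by (simp add: continuous_on_eq_continuous_at)
      from isCont_tendsto_compose[OF this t(3)]
      have "(\<lambda>k. ker_dist (v + t k *\<^sub>R q) v) \<longlonglongrightarrow> 0" by simp
      then have "(\<lambda>k. (cmod (fock_ker w q * of_real (ker_dist (v + t k *\<^sub>R q) v)))\<^sup>2) \<longlonglongrightarrow>
          (cmod (fock_ker w q * of_real 0))\<^sup>2"
        by (intro tendsto_intros)
      then show "(\<lambda>k. (cmod (shift_error v w (t k) q))\<^sup>2) \<longlonglongrightarrow> 0"
        by (simp add: shift_error_def)
    qed
    show "(\<lambda>q. (cmod (shift_error v w (t k) q))\<^sup>2) \<in> borel_measurable fock_measure" for k
      using shift_error_measurable[of v w "t k"] by simp
    show "AE q in fock_measure. norm ((cmod (shift_error v w (t k) q))\<^sup>2) \<le> (b q)\<^sup>2" for k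
      using shift_error_le[OF t(1) t(2), of v w k] by (intro AE_I2) (simp add: b_def power_mono)
  qed simp
  from tendsto_real_sqrt[OF this] show ?thesis
    by (simp add: fock_norm_def)
qed

text \<open>The Hilbert-Schmidt norm bounds the operator norm: \<open>fock_lipschitz\<close> is
  applied pointwise in \<open>q\<close>, before any integration.\<close>

lemma fock_shift_norm_le:
  assumes f: "f \<in> fock_space" and t: "0 \<le> t" "t \<le> 1 / 2"
  shows "fock_norm (\<lambda>q. fock_ker w q * f (v + t *\<^sub>R q) - fock_ker w q * f v) \<le>
    fock_norm f * fock_norm (shift_error v w t)"
proof -
  have "fock_norm (\<lambda>q. fock_ker w q * f (v + t *\<^sub>R q) - fock_ker w q * f v) \<le>
      fock_norm (\<lambda>q. of_real (fock_norm f) * shift_error v w t q)"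
  proof (rule fock_norm_mono)
    show "(\<lambda>q. fock_ker w q * f (v + t *\<^sub>R q) - fock_ker w q * f v) \<in> fock_L2"
      using fock_ker_mult_shift_space[OF f t, of w v] fock_L2_cmult[OF fock_ker_L2, of "f v" w]
      by (intro fock_L2_diff) (auto simp: fock_space_L2 mult.commute)
    show "(\<lambda>q. of_real (fock_norm f) * shift_error v w t q) \<in> fock_L2"
      by (intro fock_L2_cmult shift_error_L2 t)
    fix q
    have "cmod (fock_ker w q * (f (v + t *\<^sub>R q) - f v)) \<le>
        cmod (fock_ker w q) * (fock_norm f * ker_dist (v + t *\<^sub>R q) v)"
      unfolding norm_mult by (intro mult_left_mono fock_lipschitz f) simp
    then show "cmod (fock_ker w q * f (v + t *\<^sub>R q) - fock_ker w q * f v) \<le>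
        cmod (of_real (fock_norm f) * shift_error v w t q)"
      by (simp add: shift_error_def norm_mult right_diff_distrib mult_ac)
  qed
  then show ?thesis by (simp add: fock_norm_cmult)
qed

text \<open>The candidate is tested against kernels for the whole sum at once, rather than adding
  values of the description \<open>fock_proj\<close>.\<close>

lemma toeplitz_gauss_symbols:
  fixes f :: "complex ^ 'n \<Rightarrow> complex"
  assumes "finite I" and f: "f \<in> fock_space" and t: "0 < t" "t \<le> 1 / 2"
  shows "toeplitz (\<lambda>z. \<Sum>i\<in>I. c i * gauss_symbol (v i) (w i) t z) f =
    (\<lambda>q. \<Sum>i\<in>I. c i * (fock_ker (w i) q * f (v i + t *\<^sub>R q)))"
  unfolding toeplitz_def
proof (rule fock_proj_eq_kerI)
  have eq: "(\<lambda>z. (\<Sum>i\<in>I. c i * gauss_symbol (v i) (w i) t z) * f z) =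
      (\<lambda>z. \<Sum>i\<in>I. c i * (gauss_symbol (v i) (w i) t z * f z))"
    by (simp add: sum_distrib_right mult.assoc)
  have L2: "(\<lambda>z. c i * (gauss_symbol (v i) (w i) t z * f z)) \<in> fock_L2" for i
    by (intro fock_L2_cmult gauss_symbol_mult_L2 fock_space_L2 f t)
  show "(\<lambda>z. (\<Sum>i\<in>I. c i * gauss_symbol (v i) (w i) t z) * f z) \<in> fock_L2"
    unfolding eq
    using fock_norm_sum_le[OF \<open>finite I\<close>, of "\<lambda>i z. c i * (gauss_symbol (v i) (w i) t z * f z)"] L2
    by simp
  show "(\<lambda>q. \<Sum>i\<in>I. c i * (fock_ker (w i) q * f (v i + t *\<^sub>R q))) \<in> fock_space"
    using t by (intro fock_space_sum \<open>finite I\<close> fock_space_cmult fock_ker_mult_shift_space f) auto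
  show "fock_inner (\<lambda>z. (\<Sum>i\<in>I. c i * gauss_symbol (v i) (w i) t z) * f z) (fock_ker q) =
      (\<Sum>i\<in>I. c i * (fock_ker (w i) q * f (v i + t *\<^sub>R q)))" for q
    unfolding eq fock_inner_sum_left[OF \<open>finite I\<close> L2 fock_ker_L2] fock_inner_cmult_left
    by (simp only: gauss_symbol_inner_ker[OF f t])
qed

lemma finite_rank_toeplitz_approx:
  fixes v w :: "'i \<Rightarrow> complex ^ 'n"
  assumes "finite I" "\<epsilon> > 0"
  shows "\<exists>a. bounded (range a) \<and> uniformly_continuous_on UNIV a \<and>
    (\<forall>f\<in>fock_space. toeplitz a f \<in> fock_space \<and>
      fock_norm (\<lambda>z. toeplitz a f z - (\<Sum>i\<in>I. c i * (fock_ker (w i) z * f (v i)))) \<le> \<epsilon> * fock_norm f)"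
proof -
  \<comment> \<open>Starting at 1 / 2 keeps every \<open>t k\<close> in the admissible
    range.\<close>
  define t where "t k = inverse (real (Suc (Suc k)))" for k
  have t: "0 < t k" "t k \<le> 1 / 2" for k
    by (auto simp: t_def field_simps)
  have t0: "0 \<le> t k" for k using t(1)[of k] by simp
  have "t \<longlonglongrightarrow> 0"
    unfolding t_def using LIMSEQ_inverse_real_of_nat by (rule LIMSEQ_Suc)
  then have "(\<lambda>k. \<Sum>i\<in>I. cmod (c i) * fock_norm (shift_error (v i) (w i) (t k))) \<longlonglongrightarrow> (\<Sum>i\<in>I. cmod (c i) * 0)"
    by (intro tendsto_intros shift_error_tendsto t t0)
  then have "\<forall>\<^sub>F k in sequentially. (\<Sum>i\<in>I. cmod (c i) * fock_norm (shift_error (v i) (w i) (t k))) < \<epsilon>"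
    using \<open>\<epsilon> > 0\<close> by (intro order_tendstoD) auto
  \<comment> \<open>This \<open>k\<close> depends on the coefficients, the points and
    \<open>\<epsilon>\<close>, but not on \<open>f\<close>; hence an approximation in operator
    norm.\<close>
  then obtain k where k: "(\<Sum>i\<in>I. cmod (c i) * fock_norm (shift_error (v i) (w i) (t k))) < \<epsilon>"
    by (auto simp: eventually_sequentially)
  define a where "a z = (\<Sum>i\<in>I. c i * gauss_symbol (v i) (w i) (t k) z)" for z
  have "continuous_on UNIV a"
    unfolding a_def by (intro continuous_intros continuous_gauss_symbol)
  moreover have "(a \<longlongrightarrow> (\<Sum>i\<in>I. c i * 0)) at_infinity"
    unfolding a_def by (intro tendsto_intros gauss_symbol_vanishes t)
  ultimately have "uniformly_continuous_on UNIV a" "bounded (range a)"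
    using vanishing_at_infinity_uniformly_continuous[of a] by simp_all
  moreover have "toeplitz a f \<in> fock_space \<and>
      fock_norm (\<lambda>z. toeplitz a f z - (\<Sum>i\<in>I. c i * (fock_ker (w i) z * f (v i)))) \<le> \<epsilon> * fock_norm f"
    if f: "f \<in> fock_space" for f
  proof
    have T: "toeplitz a f = (\<lambda>q. \<Sum>i\<in>I. c i * (fock_ker (w i) q * f (v i + t k *\<^sub>R q)))"
      unfolding a_def by (rule toeplitz_gauss_symbols[OF \<open>finite I\<close> f t])
    show "toeplitz a f \<in> fock_space"
      unfolding T by (intro fock_space_sum \<open>finite I\<close> fock_space_cmult fock_ker_mult_shift_space f t t0)
    define d where "d i q = c i * (fock_ker (w i) q * f (v i + t k *\<^sub>R q) - fock_ker (w i) q * f (v i))" for i q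
    have d_L2: "d i \<in> fock_L2" for i
      unfolding d_def
      using fock_ker_mult_shift_space[OF f t0 t(2), of "w i" "v i" k] fock_L2_cmult[OF fock_ker_L2, of "f (v i)" "w i"]
      by (intro fock_L2_cmult fock_L2_diff) (auto simp: fock_space_L2 mult.commute)
    have "(\<lambda>z. toeplitz a f z - (\<Sum>i\<in>I. c i * (fock_ker (w i) z * f (v i)))) = (\<lambda>z. \<Sum>i\<in>I. d i z)"
      by (simp add: T d_def sum_subtractf right_diff_distrib)
    then have "fock_norm (\<lambda>z. toeplitz a f z - (\<Sum>i\<in>I. c i * (fock_ker (w i) z * f (v i)))) \<le>
        (\<Sum>i\<in>I. fock_norm (d i))"
      using fock_norm_sum_le[OF \<open>finite I\<close>, of d, OF d_L2] by simp
    also have "\<dots> \<le> (\<Sum>i\<in>I. cmod (c i) * (fock_norm f * fock_norm (shift_error (v i) (w i) (t k))))"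
      unfolding d_def fock_norm_cmult
      by (intro sum_mono mult_left_mono fock_shift_norm_le f t t0) simp
    also have "\<dots> = (\<Sum>i\<in>I. cmod (c i) * fock_norm (shift_error (v i) (w i) (t k))) * fock_norm f"
      by (simp add: sum_distrib_left mult_ac)
    also have "\<dots> \<le> \<epsilon> * fock_norm f"
      using k by (intro mult_right_mono) auto
    finally show "fock_norm (\<lambda>z. toeplitz a f z - (\<Sum>i\<in>I. c i * (fock_ker (w i) z * f (v i)))) \<le> \<epsilon> * fock_norm f" .
  qed
  ultimately show ?thesis by blast
qed

subsection \<open>Approximation of bounded operators\<close>

lemma fock_bounded_operator_sum:
  assumes S: "fock_bounded_operator S" and "finite I" "\<And>i. i \<in> I \<Longrightarrow> g i \<in> fock_space"
  shows "S (\<lambda>z. \<Sum>i\<in>I. c i * g i z) = (\<lambda>z. \<Sum>i\<in>I. c i * S (g i) z)"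
  using assms(2,3)
proof (induction I)
  case empty
  \<comment> \<open>The empty sum is a zero multiple, so homogeneity gives its image.\<close>
  have "S (\<lambda>z. 0 * f z) = (\<lambda>z. 0 * S f z)" if "f \<in> fock_space" for f
    using S that unfolding fock_bounded_operator_def by blast
  from this[OF fock_space_zero] show ?case by simp
next
  case (insert i I)
  have add: "S (\<lambda>z. f z + h z) = (\<lambda>z. S f z + S h z)" if "f \<in> fock_space" "h \<in> fock_space" for f h
    using S that unfolding fock_bounded_operator_def by blast
  have "S (\<lambda>z. c i * g i z + (\<Sum>i\<in>I. c i * g i z)) = (\<lambda>z. S (\<lambda>z. c i * g i z) z + S (\<lambda>z. \<Sum>i\<in>I. c i * g i z) z)"
    using insert.prems insert.hyps by (intro add fock_space_sum fock_space_cmult) auto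
  moreover have "S (\<lambda>z. c i * g i z) = (\<lambda>z. c i * S (g i) z)"
    using S insert.prems unfolding fock_bounded_operator_def by blast
  ultimately show ?case
    using insert by simp
qed

lemma fock_bounded_operator_diff:
  assumes S: "fock_bounded_operator S" and f: "f \<in> fock_space" and g: "g \<in> fock_space"
  shows "S (\<lambda>z. f z - g z) = (\<lambda>z. S f z - S g z)"
  using fock_bounded_operator_sum[OF S, of "{True, False}" "\<lambda>b. if b then f else g" "\<lambda>b. if b then 1 else - 1"] f g
  by simp

lemma sample_op_diff: "sample_op N p \<mu> (\<lambda>z. f z - g z) = (\<lambda>z. sample_op N p \<mu> f z - sample_op N p \<mu> g z)"
  by (simp add: sample_op_def sum_subtractf algebra_simps)

text \<open>\<open>S\<close> survives only in the matrix entries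
  \<open>S (fock_ker (p i)) (p j)\<close>, the inner products of S K_{p i} with K_{p j}. Each entry
  multiplies the rank one operator that evaluates at \<open>p i\<close> and returns the kernel at
  \<open>p j\<close>.\<close>

lemma sample_op_sandwich:
  assumes S: "fock_bounded_operator S"
  shows "sample_op N p \<mu> (S (sample_op N p \<mu> f)) = (\<lambda>z. \<Sum>(i, j)\<in>{..<N} \<times> {..<N}.
    of_real (\<mu> i) * of_real (\<mu> j) * S (fock_ker (p i)) (p j) * (fock_ker (p j) z * f (p i)))"
proof
  fix z
  have SQ: "S (sample_op N p \<mu> f) = (\<lambda>z. \<Sum>i<N. (of_real (\<mu> i) * f (p i)) * S (fock_ker (p i)) z)"
    unfolding sample_op_def by (intro fock_bounded_operator_sum[OF S] fock_ker_space) simp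
  have "sample_op N p \<mu> (S (sample_op N p \<mu> f)) z = (\<Sum>j<N. \<Sum>i<N.
      of_real (\<mu> i) * of_real (\<mu> j) * S (fock_ker (p i)) (p j) * (fock_ker (p j) z * f (p i)))"
    unfolding SQ
    by (simp add: sample_op_def sum_distrib_left sum_distrib_right mult_ac)
  also have "\<dots> = (\<Sum>i<N. \<Sum>j<N.
      of_real (\<mu> i) * of_real (\<mu> j) * S (fock_ker (p i)) (p j) * (fock_ker (p j) z * f (p i)))"
    by (rule sum.swap)
  finally show "sample_op N p \<mu> (S (sample_op N p \<mu> f)) z = (\<Sum>(i, j)\<in>{..<N} \<times> {..<N}.
    of_real (\<mu> i) * of_real (\<mu> j) * S (fock_ker (p i)) (p j) * (fock_ker (p j) z * f (p i)))"
    by (simp add: sum.cartesian_product)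
qed

theorem theorem6p2:
  fixes S :: "(complex ^ 'n \<Rightarrow> complex) \<Rightarrow> (complex ^ 'n \<Rightarrow> complex)"
  assumes "fock_bounded_operator S"
  shows "\<exists>a :: nat \<Rightarrow> complex ^ 'n \<Rightarrow> complex.
    (\<forall>k. bounded (range (a k)) \<and> uniformly_continuous_on UNIV (a k)) \<and>
    fock_SOT_converges (\<lambda>k. toeplitz (a k)) S"
proof -
  note S = assms
  have S_space: "S f \<in> fock_space" if "f \<in> fock_space" for f
    using S that unfolding fock_bounded_operator_def by blast
  obtain C where "\<And>f. f \<in> fock_space \<Longrightarrow> fock_norm (S f) \<le> C * fock_norm f"
    using S unfolding fock_bounded_operator_def by blast
  then have C: "fock_norm (S f) \<le> C * fock_norm f" if "f \<in> fock_space" for f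
    using that by blast
  obtain N and p :: "nat \<Rightarrow> nat \<Rightarrow> complex ^ 'n" and \<mu> where
    Q_bound: "\<And>m f. f \<in> fock_space \<Longrightarrow> fock_norm (sample_op (N m) (p m) (\<mu> m) f) \<le> 3 * fock_norm f" and
    Q_lim: "\<And>f. f \<in> fock_space \<Longrightarrow> (\<lambda>m. fock_norm (\<lambda>z. sample_op (N m) (p m) (\<mu> m) f z - f z)) \<longlonglongrightarrow> 0"
    by (rule fock_quadrature_sequence) blast
  define Q where "Q m = sample_op (N m) (p m) (\<mu> m)" for m
  define P where "P m a \<longleftrightarrow> bounded (range a) \<and> uniformly_continuous_on UNIV a \<and>
    (\<forall>f\<in>fock_space. toeplitz a f \<in> fock_space \<and>
      fock_norm (\<lambda>z. toeplitz a f z - Q m (S (Q m f)) z) \<le> inverse (real (Suc m)) * fock_norm f)" for m a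
  have "\<exists>a. P m a" for m
    \<comment> \<open>The kernel points \<open>p m j\<close> instantiate \<open>w\<close>, the
      evaluation points \<open>p m i\<close> instantiate \<open>v\<close>.\<close>
    using finite_rank_toeplitz_approx[of "{..<N m} \<times> {..<N m}" "inverse (real (Suc m))"
        "\<lambda>(i, j). of_real (\<mu> m i) * of_real (\<mu> m j) * S (fock_ker (p m i)) (p m j)"
        "\<lambda>(i, j). p m j" "\<lambda>(i, j). p m i"]
    unfolding P_def Q_def sample_op_sandwich[OF S] by (simp add: case_prod_beta del: of_nat_Suc)
  then obtain a where "P m (a m)" for m
    by metis
  then have a: "bounded (range (a m))" "uniformly_continuous_on UNIV (a m)"
    and Ta: "f \<in> fock_space \<Longrightarrow> toeplitz (a m) f \<in> fock_space"
    and Ta_bound: "f \<in> fock_space \<Longrightarrow>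
      fock_norm (\<lambda>z. toeplitz (a m) f z - Q m (S (Q m f)) z) \<le> inverse (real (Suc m)) * fock_norm f" for m f
    unfolding P_def by blast+
  have "(\<lambda>m. fock_norm (\<lambda>z. toeplitz (a m) f z - S f z)) \<longlonglongrightarrow> 0" if f: "f \<in> fock_space" for f
  proof -
    let ?b = "\<lambda>m. inverse (real (Suc m)) * fock_norm f + 3 * (C * fock_norm (\<lambda>z. Q m f z - f z)) +
      fock_norm (\<lambda>z. Q m (S f) z - S f z)"
    have Q: "Q m g \<in> fock_space" for m g
      unfolding Q_def by (rule sample_op_space)
    have "norm (fock_norm (\<lambda>z. toeplitz (a m) f z - S f z)) \<le> ?b m" for m
    proof -
      \<comment> \<open>The difference splits into T - Q S Q, Q S (Q - 1) and (Q - 1) S applied to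
        \<open>f\<close>. The middle term is where strong convergence alone would not do: it takes
        the uniform bound on the operators Q_m and the boundedness of \<open>S\<close>.\<close>
      let ?x = "\<lambda>z. toeplitz (a m) f z - Q m (S (Q m f)) z"
      let ?y = "\<lambda>z. Q m (S (Q m f)) z - Q m (S f) z"
      let ?z = "\<lambda>z. Q m (S f) z - S f z"
      have L2: "?x \<in> fock_L2" "?y \<in> fock_L2" "?z \<in> fock_L2"
        by (intro fock_L2_diff fock_space_L2 Ta Q S_space f)+
      have "?y = Q m (S (\<lambda>z. Q m f z - f z))"
        unfolding fock_bounded_operator_diff[OF S Q f] unfolding Q_def sample_op_diff ..
      then have "fock_norm ?y \<le> 3 * fock_norm (S (\<lambda>z. Q m f z - f z))"
        unfolding Q_def by (metis Q_bound Q_def Q S_space f fock_space_diff)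
      also have "\<dots> \<le> 3 * (C * fock_norm (\<lambda>z. Q m f z - f z))"
        by (intro mult_left_mono C fock_space_diff Q f) simp
      finally have y: "fock_norm ?y \<le> 3 * (C * fock_norm (\<lambda>z. Q m f z - f z))" .
      have "fock_norm (\<lambda>z. toeplitz (a m) f z - S f z) = fock_norm (\<lambda>z. ?x z + ?y z + ?z z)"
        by simp
      also have "\<dots> \<le> fock_norm ?x + fock_norm ?y + fock_norm ?z"
        by (intro order_trans[OF fock_norm_triangle] add_right_mono fock_norm_triangle fock_L2_add L2)
      also have "\<dots> \<le> ?b m"
        by (intro add_mono y Ta_bound f order_refl)
      finally show ?thesis by simp
    qed
    then have le: "\<forall>\<^sub>F m in sequentially. norm (fock_norm (\<lambda>z. toeplitz (a m) f z - S f z)) \<le> ?b m"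
      by (intro always_eventually allI)
    have "?b \<longlonglongrightarrow> 0 * fock_norm f + 3 * (C * 0) + 0"
      unfolding Q_def by (intro tendsto_intros LIMSEQ_inverse_real_of_nat Q_lim S_space f)
    then have "?b \<longlonglongrightarrow> 0" by (simp only: mult_zero_left mult_zero_right add_0_left)
    from Lim_null_comparison[OF le this] show ?thesis .
  qed
  then show ?thesis
    unfolding fock_SOT_converges_def using a by blast
qed

end
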